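(* Let $A>0$, and let $\alpha,\beta\in\mathbb{R}$ satisfy $\alpha\le\beta\le 1$, $\beta>0$, $\alpha<1$. Let $a_{i,j}=A(i^\alpha j^\beta+i^\beta j^\alpha)$ for $i,j\ge1$, and let $(B_{j,k}^i)$ be a daughter distribution function satisfying conditions (B1), (B2), (B3) of the context. (a) Assume further that $\sum_{i=1}^{j+k-1}B_{j,k}^i=2$ for all $j,k\ge1$. Then, given $\rho_1>\rho_0>0$, there is at least one stationary solution $w^\star\in Y_1^+$ to the discrete collision-induced breakage equation satisfying $$M_1(w^\star)=\rho_1>\rho_0=M_0(w^\star)$$ and $w^\star\in\bigcap_{m\ge1}Y_m$. (b) Assume further that $$\sum_{i=2}^jB_{1,j}^i\ge1,\qquad\sum_{i=2}^{j+k-1}B_{j,k}^i\ge2,\qquad j,k\ge2.$$ Then, given $\rho_1>\rho_0>0$, there is at least one stationary solution $w^\star\in Y_1^+$ to the discrete collision-induced breakage equation satisfying $w^\star\in\bigcap_{m\ge1}Y_m$ and $$M_1(w^\star)=\rho_1,\qquad M_0(w^\star)\ge\rho_0\qquad\text{and}\qquad w_1^\star<M_0(w^\star).$$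
   Context: Spaces and moments. For $\gamma\ge0$, $Y_\gamma$ is the Banach space of real sequences $y=(y_i)_{i\ge1}$ with $\|y\|_\gamma=\sum_{i\ge1}i^\gamma|y_i|<\infty$, and $Y_\gamma^+=\{y\in Y_\gamma: y_i\ge0 \text{ for all } i\ge 1\}$. For a non-negative sequence $w$, $M_\gamma(w)=\sum_{i\ge1}i^\gamma w_i$. Equation. The discrete collision-induced breakage equation is, for $i\ge1$, $$\frac{dw_i}{dt}=\frac12\sum_{j=i+1}^\infty\sum_{k=1}^{j-1}B_{j-k,k}^i\,a_{j-k,k}\,w_{j-k}w_k-\sum_{j=1}^\infty a_{i,j}w_iw_j.$$ Conditions on the daughter distribution function $(B_{i,j}^s)$, $i,j,s\ge1$: (B1) for all $i,j\ge1$: $B_{i,j}^s=B_{j,i}^s\ge0$ for $1\le s\le i+j-1$, $B_{i,j}^s=0$ for $s\ge i+j$, and $\sum_{s=1}^{i+j-1}sB_{i,j}^s=i+j$; (B2) for each $m>1$ there are constants $\epsilon_m\in(0,1)$ and $\kappa_m\ge1$ such that, for all $j,k\ge1$, $\sum_{i=1}^{j+k-1}i^mB_{j,k}^i\le(1-\epsilon_m)(j^m+k^m)+\kappa_m(jk^{m-1}+j^{m-1}k)$; (B3) $\sum_{i=1}^{j+k-1}B_{j,k}^i\ge2$ for all $j,k\ge1$. Solutions. Let $T\in(0,+\infty]$ and $w^{\rm in}\in Y_1^+$. A solution on $[0,T)$ with initial condition $w^{\rm in}$ is a sequence $w=(w_i)_{i\ge1}$ of non-negative continuous functions such that, for each $i\ge1$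 and $t\in(0,T)$: $w_i\in C([0,t))$, $\sum_{j}a_{i,j}w_j\in L^1(0,t)$, $\sum_{j=i+1}^\infty\sum_{k=1}^{j-1}B_{j-k,k}^ia_{j-k,k}w_{j-k}w_k\in L^1(0,t)$, and $$w_i(t)=w_i^{\rm in}+\int_0^t\Big(\frac12\sum_{j=i+1}^\infty\sum_{k=1}^{j-1}B_{j-k,k}^ia_{j-k,k}w_{j-k}(\tau)w_k(\tau)-\sum_{j=1}^\infty a_{i,j}w_i(\tau)w_j(\tau)\Big)d\tau.$$ A stationary solution is a sequence $w^\star\in Y_1^+$ such that the constant-in-time function $w(t)=w^\star$, $t\ge0$, is a solution on $[0,+\infty)$ with initial condition $w^\star$. *)

theory Defs
  imports "HOL-Analysis.Analysis"
begin

text \<open>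
  A sequence indexed by the integers \<open>i \<ge> 1\<close> is a function on \<^typ>\<open>nat\<close>; all sums and conditions
  range over indices \<open>\<ge> 1\<close> only, so the value at \<open>0\<close> is irrelevant. A kernel value is \<open>a i j\<close>, and
  \<open>B i j s\<close> stands for the coefficient with subscripts \<open>i, j\<close> and superscript \<open>s\<close>.
\<close>

definition Y :: "real \<Rightarrow> (nat \<Rightarrow> real) set" where
  "Y \<gamma> = {y. (\<lambda>i. real i powr \<gamma> * \<bar>y i\<bar>) summable_on {1..}}"

definition Y_plus :: "real \<Rightarrow> (nat \<Rightarrow> real) set" where
  "Y_plus \<gamma> = {y \<in> Y \<gamma>. \<forall>i\<ge>1. 0 \<le> y i}"

text \<open>
  The moment is real-valued, hence meaningful only for non-negative elements of \<^term>\<open>Y \<gamma>\<close>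
  (outside, \<^const>\<open>infsum\<close> returns \<open>0\<close>).
\<close>

definition moment :: "real \<Rightarrow> (nat \<Rightarrow> real) \<Rightarrow> real" where
  "moment \<gamma> w = (\<Sum>\<^sub>\<infinity>i\<in>{1..}. real i powr \<gamma> * w i)"

definition condB1 :: "(nat \<Rightarrow> nat \<Rightarrow> nat \<Rightarrow> real) \<Rightarrow> bool" where
  "condB1 B \<longleftrightarrow> (\<forall>i\<ge>1. \<forall>j\<ge>1.
     (\<forall>s\<in>{1..i + j - 1}. B i j s = B j i s \<and> 0 \<le> B i j s) \<and>
     (\<forall>s\<ge>i + j. B i j s = 0) \<and>
     (\<Sum>s = 1..i + j - 1. real s * B i j s) = real (i + j))"

definition condB2 :: "(nat \<Rightarrow> nat \<Rightarrow> nat \<Rightarrow> real) \<Rightarrow> bool" where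
  "condB2 B \<longleftrightarrow> (\<forall>m::real. m > 1 \<longrightarrow> (\<exists>\<epsilon> \<kappa>. 0 < \<epsilon> \<and> \<epsilon> < 1 \<and> 1 \<le> \<kappa> \<and>
     (\<forall>j\<ge>1. \<forall>k\<ge>1.
        (\<Sum>i = 1..j + k - 1. real i powr m * B j k i)
          \<le> (1 - \<epsilon>) * (real j powr m + real k powr m)
             + \<kappa> * (real j * real k powr (m - 1) + real j powr (m - 1) * real k))))"

definition condB3 :: "(nat \<Rightarrow> nat \<Rightarrow> nat \<Rightarrow> real) \<Rightarrow> bool" where
  "condB3 B \<longleftrightarrow> (\<forall>j\<ge>1. \<forall>k\<ge>1. 2 \<le> (\<Sum>i = 1..j + k - 1. B j k i))"

definition gain_term ::
  "(nat \<Rightarrow> nat \<Rightarrow> real) \<Rightarrow> (nat \<Rightarrow> nat \<Rightarrow> nat \<Rightarrow> real) \<Rightarrow> (nat \<Rightarrow> real) \<Rightarrow> nat \<Rightarrow> nat \<Rightarrow> real" where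
  "gain_term a B w i j = (\<Sum>k = 1..j - 1. B (j - k) k i * a (j - k) k * w (j - k) * w k)"

definition breakage_rhs ::
  "(nat \<Rightarrow> nat \<Rightarrow> real) \<Rightarrow> (nat \<Rightarrow> nat \<Rightarrow> nat \<Rightarrow> real) \<Rightarrow> (nat \<Rightarrow> real) \<Rightarrow> nat \<Rightarrow> real" where
  "breakage_rhs a B w i =
     1 / 2 * (\<Sum>\<^sub>\<infinity>j\<in>{i + 1..}. gain_term a B w i j) - (\<Sum>\<^sub>\<infinity>j\<in>{1..}. a i j * w i * w j)"

text \<open>
  Membership in \<open>L\<^sup>1(0,t)\<close> of a series of non-negative functions. The series may diverge at some
  times; since \<^const>\<open>infsum\<close> is \<open>0\<close> there, almost everywhere convergence has to be
  required separately.
\<close>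

definition series_in_L1 :: "real \<Rightarrow> nat set \<Rightarrow> (real \<Rightarrow> nat \<Rightarrow> real) \<Rightarrow> bool" where
  "series_in_L1 t J f \<longleftrightarrow>
     (AE \<tau> in lborel. \<tau> \<in> {0<..<t} \<longrightarrow> f \<tau> summable_on J) \<and>
     set_integrable lborel {0<..<t} (\<lambda>\<tau>. \<Sum>\<^sub>\<infinity>j\<in>J. f \<tau> j)"

text \<open>\<open>w \<tau> i\<close> is the value of the \<open>i\<close>-th component at time \<open>\<tau>\<close>.\<close>

definition is_solution ::
  "(nat \<Rightarrow> nat \<Rightarrow> real) \<Rightarrow> (nat \<Rightarrow> nat \<Rightarrow> nat \<Rightarrow> real) \<Rightarrow> ereal \<Rightarrow> (nat \<Rightarrow> real)
    \<Rightarrow> (real \<Rightarrow> nat \<Rightarrow> real) \<Rightarrow> bool" where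
  "is_solution a B T w_in w \<longleftrightarrow>
     0 < T \<and> w_in \<in> Y_plus 1 \<and>
     (\<forall>i\<ge>1. \<forall>\<tau>. 0 \<le> \<tau> \<and> ereal \<tau> < T \<longrightarrow> 0 \<le> w \<tau> i) \<and>
     (\<forall>i\<ge>1. \<forall>t. 0 < t \<and> ereal t < T \<longrightarrow>
        continuous_on {0..<t} (\<lambda>\<tau>. w \<tau> i) \<and>
        series_in_L1 t {1..} (\<lambda>\<tau> j. a i j * w \<tau> j) \<and>
        series_in_L1 t {i + 1..} (\<lambda>\<tau> j. gain_term a B (w \<tau>) i j) \<and>
        w t i = w_in i + (LINT \<tau>:{0<..<t}|lborel. breakage_rhs a B (w \<tau>) i))"

definition stationary_solution ::
  "(nat \<Rightarrow> nat \<Rightarrow> real) \<Rightarrow> (nat \<Rightarrow> nat \<Rightarrow> nat \<Rightarrow> real) \<Rightarrow> (nat \<Rightarrow> real) \<Rightarrow> bool" where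
  "stationary_solution a B w \<longleftrightarrow> w \<in> Y_plus 1 \<and> is_solution a B \<infinity> w (\<lambda>_. w)"

end

theory Submission
  imports Defs "HOL-Complex_Analysis.Great_Picard"
begin

text \<open>
  The stationary solution is a limit of stationary states of finite systems, which in turn come
  from Brouwer's fixed point theorem.

  \<^emph>\<open>Finite systems.\<close> Only sizes up to \<open>N\<close> are kept. A collision of sizes \<open>j, k \<le> N\<close> that could produce
  a fragment larger than \<open>N\<close> is replaced by one whose outcome is two clusters of size as close to
  \<open>(j + k) / 2\<close> as possible. This keeps mass and number, stays inside \<open>{1..N}\<close>, and is
  compatible with (B2), because a balanced pair has small higher moments. The resulting vector
  field \<open>net\<close> is quadratic, conserves mass, and a short Euler step preserves positivity; so the
  Euler map sends the simplex of non-negative states of mass \<open>\<rho>\<^sub>1\<close> to itself.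

  \<^emph>\<open>Selecting the state.\<close> Pure monomers are always stationary, hence a bare fixed point says
  nothing. A relaxation term \<open>\<delta> (v - w)\<close> towards a state \<open>v\<close> of mass \<open>\<rho>\<^sub>1\<close> and number \<open>\<rho>\<^sub>0\<close>
  is therefore added. If no collision decreases \<open>\<Sum>i. \<phi> i * w i\<close>, testing the relaxed equation with \<open>\<phi>\<close> gives
  \<open>\<Sum>i. \<phi> i * w i \<ge> \<Sum>i. \<phi> i * v i\<close>, whatever \<open>\<delta> > 0\<close> is (\<open>relaxed_steady_monotone\<close>).
  In part (a) the choices \<open>\<phi> = 1\<close> and \<open>\<phi> = -1\<close> fix the number; in part (b) \<open>\<phi> = 1\<close> bounds it from
  below, and the indicator of the sizes \<open>\<ge> 2\<close> keeps some clusters away from size \<open>1\<close>.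

  \<^emph>\<open>Uniform decay.\<close> Let \<open>M(\<gamma>)\<close> denote the moment \<open>\<Sum>i. i powr \<gamma> * w i\<close>. Testing with \<open>i powr m\<close>, (B2)
  bounds \<open>\<epsilon> M(\<alpha>) M(m + \<beta>)\<close> by the cross terms \<open>a j k (j k powr (m - 1) + j powr (m - 1) k)\<close>. After extracting
  the factor \<open>j k\<close>, whose sum is the square of the mass, these have degree \<open>m - 2 + \<beta> + max \<alpha> 0\<close>, which is less
  than \<open>m - 1 + \<beta>\<close> exactly because \<open>\<alpha> < 1\<close>; they are absorbed into the left-hand side. Since mass and number
  bound \<open>M(\<alpha>)\<close> from below, every moment is bounded independently of \<open>N\<close> and \<open>\<delta>\<close>
  (\<open>relaxed_steady_decay\<close>). A coordinatewise convergent subsequence then passes to the limit in all series by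
  dominated convergence, as \<open>N\<close> tends to infinity and \<open>\<delta>\<close> to zero (\<open>balanced_exists\<close>).
\<close>

section \<open>Fixed points in the Hilbert cube and in a simplex\<close>

lemma tendsto_fun_coordinatewise:
  fixes X :: "nat \<Rightarrow> nat \<Rightarrow> real"
  assumes "\<And>i. (\<lambda>n. X n i) \<longlonglongrightarrow> z i"
  shows "X \<longlonglongrightarrow> z"
proof -
  have "limitin (product_topology (\<lambda>i. euclidean) UNIV) X z sequentially"
    using assms by (auto simp: limitin_componentwise)
  then show ?thesis
    by (simp add: euclidean_product_topology)
qed

text \<open>
  Kuhn's combinatorial lemma on the grid \<open>{0..p}\<close> with \<open>p\<close> coordinates yields a cell such that, for every
  \<open>i < p\<close>, two of its corners \<open>r, s\<close> satisfy \<open>r i \<le> G r i\<close> and \<open>G s i \<le> s i\<close>. As \<open>p\<close> grows, the mesh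
  shrinks while more and more coordinates are controlled, so a limit point of the cells is fixed
  in all coordinates. Treating all coordinates at once serves every finite dimension with a single type.
\<close>

lemma hilbert_cube_fixed_point:
  fixes G :: "(nat \<Rightarrow> real) \<Rightarrow> nat \<Rightarrow> real" and R :: real
  defines "C \<equiv> {x. \<forall>i. 0 \<le> x i \<and> x i \<le> R}"
  assumes "0 \<le> R"
    and into: "\<And>x. x \<in> C \<Longrightarrow> G x \<in> C"
    and cont: "\<And>i. continuous_on C (\<lambda>x. G x i)"
  shows "\<exists>x\<in>C. G x = x"
proof -
  \<comment> \<open>the grid point \<open>q\<close> of mesh \<open>R / p\<close>, padded by zeros beyond the first \<open>p\<close> coordinates\<close>
  define pt where "pt p q = (\<lambda>j. if j < p then R * real (q j) / real p else 0)"
    for p :: nat and q :: "nat \<Rightarrow> nat"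
  have pt_C: "pt p q \<in> C" if "\<forall>j<p. q j \<le> p" for p q
  proof -
    have "0 \<le> pt p q j \<and> pt p q j \<le> R" for j
    proof (cases "j < p")
      case True
      then have "R * real (q j) / real p \<le> R * real p / real p"
        using that \<open>0 \<le> R\<close> by (intro divide_right_mono mult_left_mono) auto
      then show ?thesis using True \<open>0 \<le> R\<close> by (simp add: pt_def)
    qed (simp add: pt_def \<open>0 \<le> R\<close>)
    then show ?thesis by (simp add: C_def)
  qed
  \<comment> \<open>the boundary values come first, as Kuhn's lemma demands \<open>1\<close> on the far face and \<open>0\<close> on the near one\<close>
  define label :: "nat \<Rightarrow> (nat \<Rightarrow> nat) \<Rightarrow> nat \<Rightarrow> nat" where
    "label p q i = (if q i = p then 1 else if q i = 0 then 0
                    else if pt p q i \<le> G (pt p q) i then 0 else 1)" for p q i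
  have label0: "pt p q i \<le> G (pt p q) i" if "\<forall>j<p. q j \<le> p" "i < p" "label p q i = 0" for p q i
  proof -
    have "0 \<le> G (pt p q) i" using into[OF pt_C[OF that(1)]] by (simp add: C_def)
    then show ?thesis using that(2,3) by (auto simp: label_def pt_def split: if_splits)
  qed
  have label1: "G (pt p q) i \<le> pt p q i" if "\<forall>j<p. q j \<le> p" "i < p" "label p q i = 1" for p q i
  proof -
    have "G (pt p q) i \<le> R" using into[OF pt_C[OF that(1)]] by (simp add: C_def)
    then show ?thesis using that(2,3) by (auto simp: label_def pt_def split: if_splits)
  qed
  define near where "near p q r \<longleftrightarrow> (\<forall>j<p. q j \<le> r j \<and> r j \<le> q j + 1)"
    for p :: nat and q r :: "nat \<Rightarrow> nat"
  define good where "good p q \<longleftrightarrow> (\<forall>i<p. q i < p) \<and> (\<forall>i<p. \<exists>r s.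
       near p q r \<and> near p q s \<and> label p r i = 0 \<and> label p s i = 1)" for p q
  have cell: "\<exists>q. good p q" for p
  proof (cases "p = 0")
    case False
    then have p: "0 < p" by simp
    obtain q where q: "\<forall>i<p. q i < p" "\<forall>i<p. \<exists>r s. (\<forall>j<p. q j \<le> r j \<and> r j \<le> q j + 1)
        \<and> (\<forall>j<p. q j \<le> s j \<and> s j \<le> q j + 1) \<and> label p r i \<noteq> label p s i"
      by (rule kuhn_lemma[of p p "label p"]) (use p in \<open>auto simp: label_def\<close>)
    have two: "label p r i = 0 \<or> label p r i = 1" for r i by (simp add: label_def)
    have "\<exists>r s. near p q r \<and> near p q s \<and> label p r i = 0 \<and> label p s i = 1" if i: "i < p" for i
    proof -
      from q(2) i obtain r s where "near p q r" "near p q s" "label p r i \<noteq> label p s i"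
        unfolding near_def by blast
      then show ?thesis
        using two[of r i] two[of s i] by (metis (no_types))
    qed
    with q(1) show ?thesis unfolding good_def by blast
  qed (simp add: good_def)
  then obtain q where good: "\<And>p. good p (q p)" by metis
  have q: "i < p \<Longrightarrow> q p i < p" for p i
    using good[of p] by (simp add: good_def)
  define sep where "sep p i u \<longleftrightarrow> near p (q p) (fst u) \<and> near p (q p) (snd u)
      \<and> label p (fst u) i = 0 \<and> label p (snd u) i = 1" for p i u
  have sep_ex: "\<exists>u. sep p i u" if "i < p" for p i
  proof -
    obtain r s where "near p (q p) r" "near p (q p) s" "label p r i = 0" "label p s i = 1"
      using good[of p] \<open>i < p\<close> unfolding good_def by blast
    then show ?thesis by (intro exI[of _ "(r, s)"]) (simp add: sep_def)
  qed
  define u where "u p i = (SOME u. sep p i u)" for p i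
  have u: "sep p i (u p i)" if "i < p" for p i
    unfolding u_def by (rule someI_ex) (rule sep_ex[OF that])
  define r s where "r p i = fst (u p i)" and "s p i = snd (u p i)" for p i
  have rs: "\<And>p i j. i < p \<Longrightarrow> j < p \<Longrightarrow>
        q p j \<le> r p i j \<and> r p i j \<le> q p j + 1 \<and> q p j \<le> s p i j \<and> s p i j \<le> q p j + 1"
    and lab: "\<And>p i. i < p \<Longrightarrow> label p (r p i) i = 0" "\<And>p i. i < p \<Longrightarrow> label p (s p i) i = 1"
    using u unfolding r_def s_def sep_def near_def by blast+
  have bnd: "norm (pt p (q p) i) \<le> R" for p i
  proof -
    have "pt p (q p) \<in> C"
      by (rule pt_C) (use q less_imp_le in blast)
    then show ?thesis by (simp add: C_def)
  qed
  obtain k where k: "strict_mono k" "\<And>i. \<exists>l. (\<lambda>n. pt (k n) (q (k n)) i) \<longlonglongrightarrow> l"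
    by (rule function_convergent_subsequence[of UNIV "\<lambda>p. pt p (q p)" R]) (use bnd in auto)
  then obtain z where z: "\<And>i. (\<lambda>n. pt (k n) (q (k n)) i) \<longlonglongrightarrow> z i"
    by metis
  have kinf: "filterlim k at_top sequentially"
    by (rule filterlim_subseq) fact
  \<comment> \<open>grid points of one cell differ by at most \<open>R / p\<close> in each coordinate\<close>
  have close: "(\<lambda>n. pt (k n) (u (k n))) \<longlonglongrightarrow> z"
    if u: "\<And>p j. i < p \<Longrightarrow> j < p \<Longrightarrow> q p j \<le> u p j \<and> u p j \<le> q p j + 1" for u i
  proof (rule tendsto_fun_coordinatewise)
    fix j
    have diff: "\<bar>pt p (u p) j - pt p (q p) j\<bar> \<le> R * (1 / real p)" if "i < p" for p
    proof (cases "j < p")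
      case True
      have "pt p (u p) j - pt p (q p) j = R * (real (u p j) - real (q p j)) / real p"
        using True by (simp add: pt_def diff_divide_distrib right_diff_distrib)
      moreover have "0 \<le> R * (real (u p j) - real (q p j)) / real p"
        using u[OF that True] \<open>0 \<le> R\<close> by simp
      moreover have "R * (real (u p j) - real (q p j)) / real p \<le> R * 1 / real p"
        using u[OF that True] \<open>0 \<le> R\<close> by (intro divide_right_mono mult_left_mono) auto
      ultimately show ?thesis by simp
    qed (simp add: pt_def \<open>0 \<le> R\<close>)
    have "(\<lambda>n. R * (1 / real (k n))) \<longlonglongrightarrow> R * 0"
      by (intro tendsto_mult tendsto_const filterlim_compose[OF lim_1_over_n kinf])
    then have lim: "(\<lambda>n. R * (1 / real (k n))) \<longlonglongrightarrow> 0"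
      by simp
    have "\<forall>\<^sub>F n in sequentially. norm (pt (k n) (u (k n)) j - pt (k n) (q (k n)) j) \<le> R * (1 / real (k n))"
      using eventually_compose_filterlim[OF eventually_gt_at_top[of i] kinf]
      by eventually_elim (simp only: real_norm_def diff)
    then have "(\<lambda>n. pt (k n) (u (k n)) j - pt (k n) (q (k n)) j) \<longlonglongrightarrow> 0"
      by (rule Lim_null_comparison[OF _ lim])
    from tendsto_add[OF this z[of j]] show "(\<lambda>n. pt (k n) (u (k n)) j) \<longlonglongrightarrow> z j"
      by simp
  qed
  have zC: "z \<in> C"
  proof -
    have "0 \<le> z i" for i
      by (rule tendsto_lowerbound[OF z]) (auto simp: pt_def \<open>0 \<le> R\<close>)
    moreover have "z i \<le> R" for i
      by (rule tendsto_upperbound[OF z]) (use bnd in \<open>auto simp: abs_le_iff\<close>)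
    ultimately show ?thesis by (simp add: C_def)
  qed
  have "G z i = z i" for i
  proof -
    have ev: "\<forall>\<^sub>F n in sequentially. i < k n"
      using eventually_compose_filterlim[OF eventually_gt_at_top[of i] kinf] .
    have le_r: "\<forall>j<p. r p i j \<le> p" and le_s: "\<forall>j<p. s p i j \<le> p" if "i < p" for p
      using rs[OF that] q by (metis Suc_eq_plus1 Suc_leI le_trans)+
    have r: "(\<lambda>n. pt (k n) (r (k n) i)) \<longlonglongrightarrow> z" and s: "(\<lambda>n. pt (k n) (s (k n) i)) \<longlonglongrightarrow> z"
      using rs by (auto intro!: close[of i])
    have evr: "\<forall>\<^sub>F n in sequentially. pt (k n) (r (k n) i) \<in> C"
      using ev by eventually_elim (intro pt_C le_r)
    have evs: "\<forall>\<^sub>F n in sequentially. pt (k n) (s (k n) i) \<in> C"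
      using ev by eventually_elim (intro pt_C le_s)
    have Gr: "(\<lambda>n. G (pt (k n) (r (k n) i)) i) \<longlonglongrightarrow> G z i"
      by (rule continuous_on_tendsto_compose[OF cont r zC evr])
    have Gs: "(\<lambda>n. G (pt (k n) (s (k n) i)) i) \<longlonglongrightarrow> G z i"
      by (rule continuous_on_tendsto_compose[OF cont s zC evs])
    have ri: "(\<lambda>n. pt (k n) (r (k n) i) i) \<longlonglongrightarrow> z i" and si: "(\<lambda>n. pt (k n) (s (k n) i) i) \<longlonglongrightarrow> z i"
      using r s by (auto intro: continuous_on_tendsto_compose[OF continuous_on_product_coordinates])
    have "\<forall>\<^sub>F n in sequentially. pt (k n) (r (k n) i) i \<le> G (pt (k n) (r (k n) i)) i"
      using ev by eventually_elim (intro label0 le_r lab)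
    then have "z i \<le> G z i"
      by (intro tendsto_le[OF _ Gr ri]) auto
    moreover have "\<forall>\<^sub>F n in sequentially. G (pt (k n) (s (k n) i)) i \<le> pt (k n) (s (k n) i) i"
      using ev by eventually_elim (intro label1 le_s lab)
    then have "G z i \<le> z i"
      by (intro tendsto_le[OF _ si Gs]) auto
    ultimately show ?thesis by simp
  qed
  with zC show ?thesis by (auto intro!: bexI[of _ z])
qed

text \<open>
  States on the sizes \<open>1, \<dots>, N\<close> are extended by zero to all of \<^typ>\<open>nat\<close>, so that states of different
  systems live in one type and index \<open>0\<close> never contributes.
\<close>

definition mass_simplex :: "nat \<Rightarrow> real \<Rightarrow> (nat \<Rightarrow> real) set" where
  "mass_simplex N \<rho> = {w. (\<forall>i. 0 \<le> w i) \<and> (\<forall>i. i \<notin> {1..N} \<longrightarrow> w i = 0)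
     \<and> (\<Sum>i = 1..N. real i * w i) = \<rho>}"

lemma mass_simplex_le:
  assumes "w \<in> mass_simplex N \<rho>"
  shows "w i \<le> \<rho>"
proof (cases "i \<in> {1..N}")
  case True
  have "1 * w i \<le> real i * w i"
    using True assms by (intro mult_right_mono) (auto simp: mass_simplex_def)
  also have "\<dots> \<le> (\<Sum>i = 1..N. real i * w i)"
    using True assms by (intro member_le_sum) (auto simp: mass_simplex_def)
  finally show ?thesis using assms by (simp add: mass_simplex_def)
next
  case False
  then have "w i = 0" using assms by (simp add: mass_simplex_def)
  moreover have "0 \<le> (\<Sum>i = 1..N. real i * w i)"
    using assms by (intro sum_nonneg) (auto simp: mass_simplex_def)
  ultimately show ?thesis using assms by (simp add: mass_simplex_def)
qed

text \<open>
  The simplex is a retract of a cube: missing mass is added as monomers, and excess mass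
  is removed by scaling.
\<close>

lemma mass_simplex_fixed_point:
  fixes f :: "(nat \<Rightarrow> real) \<Rightarrow> nat \<Rightarrow> real"
  assumes "1 \<le> N" "0 < \<rho>"
    and into: "\<And>w. w \<in> mass_simplex N \<rho> \<Longrightarrow> f w \<in> mass_simplex N \<rho>"
    and cont: "\<And>i. continuous_on (mass_simplex N \<rho>) (\<lambda>w. f w i)"
  shows "\<exists>w\<in>mass_simplex N \<rho>. f w = w"
proof -
  define C where "C = {x::nat \<Rightarrow> real. \<forall>i. 0 \<le> x i \<and> x i \<le> \<rho>}"
  define s :: "(nat \<Rightarrow> real) \<Rightarrow> real" where "s x = (\<Sum>i = 1..N. real i * x i)" for x
  \<comment> \<open>the retraction; at most one of its two corrections is active for a given \<open>x\<close>\<close>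
  define r :: "(nat \<Rightarrow> real) \<Rightarrow> nat \<Rightarrow> real" where
    "r x i = (if i \<in> {1..N} then (x i + (if i = 1 then max 0 (\<rho> - s x) else 0)) * (\<rho> / max \<rho> (s x))
              else 0)" for x i
  have cont_coord: "continuous_on C (\<lambda>x. x i)" for i :: nat
    by (rule continuous_on_subset[OF continuous_on_product_coordinates subset_UNIV])
  have r_into: "r x \<in> mass_simplex N \<rho>" if "x \<in> C" for x
  proof -
    have "real i * r x i = (real i * x i + (if i = 1 then max 0 (\<rho> - s x) else 0)) * (\<rho> / max \<rho> (s x))"
      if "i \<in> {1..N}" for i
      using that by (simp add: r_def distrib_left)
    then have "(\<Sum>i = 1..N. real i * r x i)
        = (\<Sum>i = 1..N. (real i * x i + (if i = 1 then max 0 (\<rho> - s x) else 0)) * (\<rho> / max \<rho> (s x)))"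
      by (rule sum.cong[OF refl])
    moreover have "(\<Sum>i = 1..N. real i * x i + (if i = 1 then max 0 (\<rho> - s x) else 0)) = max \<rho> (s x)"
      using \<open>1 \<le> N\<close> by (simp add: sum.distrib s_def max_def)
    ultimately have "(\<Sum>i = 1..N. real i * r x i) = max \<rho> (s x) * (\<rho> / max \<rho> (s x))"
      by (simp only: sum_distrib_right[symmetric])
    also have "\<dots> = \<rho>"
      using \<open>0 < \<rho>\<close> by simp
    finally have "(\<Sum>i = 1..N. real i * r x i) = \<rho>" .
    moreover have "0 \<le> r x i" for i
      using that \<open>0 < \<rho>\<close> by (auto simp: r_def C_def intro!: mult_nonneg_nonneg divide_nonneg_nonneg)
    ultimately show ?thesis by (auto simp: mass_simplex_def r_def)
  qed
  have r_id: "r w = w" if "w \<in> mass_simplex N \<rho>" for w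
  proof -
    have "s w = \<rho>" using that by (simp add: mass_simplex_def s_def)
    then show ?thesis using that \<open>0 < \<rho>\<close> by (auto simp: r_def mass_simplex_def)
  qed
  have sub: "mass_simplex N \<rho> \<subseteq> C"
    using mass_simplex_le by (auto simp: C_def mass_simplex_def)
  have cont_s: "continuous_on C s"
    unfolding s_def by (intro continuous_intros cont_coord)
  have nz: "max \<rho> (s x) \<noteq> 0" for x
    using \<open>0 < \<rho>\<close> by (simp add: max_def)
  have cont_add: "continuous_on C (\<lambda>x. if i = 1 then max 0 (\<rho> - s x) else 0)" for i :: nat
    by (cases "i = 1"; simp only: if_True if_False simp_thms)
       (intro continuous_on_max continuous_on_diff continuous_on_const cont_s)+
  have cont_scale: "continuous_on C (\<lambda>x. \<rho> / max \<rho> (s x))"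
    using nz by (intro continuous_on_divide continuous_on_max continuous_on_const cont_s) blast
  have "continuous_on C (\<lambda>x. r x i)" for i
    unfolding r_def
    by (cases "i \<in> {1..N}"; simp only: if_True if_False)
       (intro continuous_on_mult continuous_on_add continuous_on_const cont_coord cont_add cont_scale)+
  then have cont_r: "continuous_on C r"
    by (rule continuous_on_coordinatewise_then_product)
  have "\<exists>x\<in>C. f (r x) = x"
  proof (rule hilbert_cube_fixed_point[of \<rho> "\<lambda>x. f (r x)", folded C_def])
    show "continuous_on C (\<lambda>x. f (r x) i)" for i
      by (rule continuous_on_compose2[OF cont[of i] cont_r]) (use r_into in blast)
    show "f (r x) \<in> C" if "x \<in> C" for x
      using into[OF r_into[OF that]] sub by blast
  qed (use \<open>0 < \<rho>\<close> in simp)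
  then obtain x where "x \<in> C" "f (r x) = x" by blast
  then show ?thesis using into r_into r_id by metis
qed

section \<open>The truncated system\<close>

locale breakage =
  fixes A \<alpha> \<beta> :: real
    and a :: "nat \<Rightarrow> nat \<Rightarrow> real"
    and B :: "nat \<Rightarrow> nat \<Rightarrow> nat \<Rightarrow> real"
  assumes A: "0 < A" and \<alpha>\<beta>: "\<alpha> \<le> \<beta>" "\<beta> \<le> 1" "0 < \<beta>" "\<alpha> < 1"
    and kernel: "\<And>i j. 1 \<le> i \<Longrightarrow> 1 \<le> j \<Longrightarrow>
           a i j = A * (real i powr \<alpha> * real j powr \<beta> + real i powr \<beta> * real j powr \<alpha>)"
    and B1: "condB1 B" and B2: "condB2 B"
begin

lemma kernel_sym: "1 \<le> i \<Longrightarrow> 1 \<le> j \<Longrightarrow> a i j = a j i"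
  by (simp add: kernel)

lemma kernel_nonneg: "1 \<le> i \<Longrightarrow> 1 \<le> j \<Longrightarrow> 0 \<le> a i j"
  using A by (simp add: kernel)

lemma B_zero: "1 \<le> j \<Longrightarrow> 1 \<le> k \<Longrightarrow> j + k \<le> i \<Longrightarrow> B j k i = 0"
  using B1 unfolding condB1_def by blast

lemma B_nonneg:
  assumes "1 \<le> j" "1 \<le> k" "1 \<le> i"
  shows "0 \<le> B j k i"
proof (cases "j + k \<le> i")
  case False
  then have "i \<in> {1..j + k - 1}" using assms by auto
  then show ?thesis using B1 assms unfolding condB1_def by blast
qed (use assms in \<open>simp add: B_zero\<close>)

lemma B_mass: "1 \<le> j \<Longrightarrow> 1 \<le> k \<Longrightarrow> (\<Sum>i = 1..j + k - 1. real i * B j k i) = real (j + k)"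
  using B1 unfolding condB1_def by blast

text \<open>
  For \<open>j + k \<le> N + 1\<close> all fragments fit into \<open>{1..N}\<close>. Otherwise two clusters are produced, so that the
  number is kept together with the mass, and they are as equal as possible, so that higher moments decrease
  up to cross terms.
\<close>

definition trunc :: "nat \<Rightarrow> nat \<Rightarrow> nat \<Rightarrow> nat \<Rightarrow> real" where
  "trunc N j k i = (if j + k \<le> N + 1 then B j k i
     else of_bool (i = (j + k) div 2) + of_bool (i = j + k - (j + k) div 2))"

definition net :: "nat \<Rightarrow> (nat \<Rightarrow> real) \<Rightarrow> nat \<Rightarrow> real" where
  "net N w i = 1 / 2 * (\<Sum>j = 1..N. \<Sum>k = 1..N. trunc N j k i * a j k * w j * w k)
     - (\<Sum>j = 1..N. a i j * w i * w j)"

lemma trunc_nonneg: "1 \<le> j \<Longrightarrow> 1 \<le> k \<Longrightarrow> 1 \<le> i \<Longrightarrow> 0 \<le> trunc N j k i"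
  by (simp add: trunc_def B_nonneg)

lemma sum_trunc:
  assumes "j \<in> {1..N}" "k \<in> {1..N}"
  shows "(\<Sum>i = 1..N. \<phi> i * trunc N j k i) =
    (if j + k \<le> N + 1 then \<Sum>i = 1..j + k - 1. \<phi> i * B j k i
     else \<phi> ((j + k) div 2) + \<phi> (j + k - (j + k) div 2))"
proof (cases "j + k \<le> N + 1")
  case True
  have "(\<Sum>i = 1..N. \<phi> i * B j k i) = (\<Sum>i = 1..j + k - 1. \<phi> i * B j k i)"
    using True assms by (intro sum.mono_neutral_right) (auto intro: B_zero)
  then show ?thesis using True by (simp add: trunc_def)
next
  case False
  have "(j + k) div 2 \<in> {1..N}" "j + k - (j + k) div 2 \<in> {1..N}"
    using False assms by auto
  moreover have "(\<Sum>i = 1..N. \<phi> i * of_bool (i = p)) = \<phi> p" if "p \<in> {1..N}" for p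
    using that by (simp add: of_bool_def if_distrib[of "\<lambda>x. _ * x"] cong: if_cong)
  ultimately show ?thesis
    using False by (simp add: trunc_def distrib_left sum.distrib)
qed

text \<open>
  The weak form: symmetrizing the loss term over the two partners of a collision exhibits the
  change of \<open>\<phi>\<close> in each collision. Conservation laws, monotone quantities and moment bounds are all read off from it.
\<close>

lemma sum_net_weak:
  "(\<Sum>i = 1..N. \<phi> i * net N w i) =
    1 / 2 * (\<Sum>j = 1..N. \<Sum>k = 1..N. a j k * w j * w k * ((\<Sum>i = 1..N. \<phi> i * trunc N j k i) - \<phi> j - \<phi> k))"
proof -
  have gain: "(\<Sum>i = 1..N. \<phi> i * (\<Sum>j = 1..N. \<Sum>k = 1..N. trunc N j k i * a j k * w j * w k))
     = (\<Sum>j = 1..N. \<Sum>k = 1..N. a j k * w j * w k * (\<Sum>i = 1..N. \<phi> i * trunc N j k i))"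
  proof -
    have "(\<Sum>i = 1..N. \<phi> i * (\<Sum>j = 1..N. \<Sum>k = 1..N. trunc N j k i * a j k * w j * w k))
      = (\<Sum>i = 1..N. \<Sum>j = 1..N. \<Sum>k = 1..N. a j k * w j * w k * (\<phi> i * trunc N j k i))"
      by (simp add: sum_distrib_left mult_ac)
    also have "\<dots> = (\<Sum>j = 1..N. \<Sum>i = 1..N. \<Sum>k = 1..N. a j k * w j * w k * (\<phi> i * trunc N j k i))"
      by (rule sum.swap)
    also have "\<dots> = (\<Sum>j = 1..N. \<Sum>k = 1..N. \<Sum>i = 1..N. a j k * w j * w k * (\<phi> i * trunc N j k i))"
      by (intro sum.cong refl sum.swap)
    finally show ?thesis by (simp add: sum_distrib_left)
  qed
  have loss: "(\<Sum>i = 1..N. \<phi> i * (\<Sum>j = 1..N. a i j * w i * w j))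
     = (\<Sum>j = 1..N. \<Sum>k = 1..N. a j k * w j * w k * \<phi> j)"
    by (simp add: sum_distrib_left mult_ac)
  also have "\<dots> = (\<Sum>j = 1..N. \<Sum>k = 1..N. a j k * w j * w k * \<phi> k)"
    by (subst sum.swap, intro sum.cong refl) (simp add: kernel_sym mult_ac)
  finally have loss': "(\<Sum>i = 1..N. \<phi> i * (\<Sum>j = 1..N. a i j * w i * w j)) = \<dots>" .
  have "(\<Sum>i = 1..N. \<phi> i * net N w i)
     = 1 / 2 * (\<Sum>i = 1..N. \<phi> i * (\<Sum>j = 1..N. \<Sum>k = 1..N. trunc N j k i * a j k * w j * w k))
       - (\<Sum>i = 1..N. \<phi> i * (\<Sum>j = 1..N. a i j * w i * w j))"
    by (simp add: net_def sum_distrib_left sum_subtractf right_diff_distrib mult_ac)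
  then show ?thesis
    unfolding right_diff_distrib sum_subtractf gain[symmetric] loss[symmetric] loss'[symmetric]
    by simp
qed

lemma net_mass: "(\<Sum>i = 1..N. real i * net N w i) = 0"
proof -
  have "(\<Sum>i = 1..N. real i * trunc N j k i) - real j - real k = 0" if "j \<in> {1..N}" "k \<in> {1..N}" for j k
    using that B_mass[of j k] unfolding sum_trunc[OF that] by auto
  then have "(\<Sum>j = 1..N. \<Sum>k = 1..N. a j k * w j * w k *
      ((\<Sum>i = 1..N. real i * trunc N j k i) - real j - real k)) = 0"
    by (intro sum.neutral ballI) (simp only: mult_zero_right)
  then show ?thesis unfolding sum_net_weak by simp
qed

text \<open>
  Weights whose total no collision decreases. They are constant on the sizes \<open>\<ge> 2\<close>, so that the
  balanced collisions of the truncated system, which involve only such sizes, do not change the total.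
\<close>

definition collision_monotone :: "(nat \<Rightarrow> real) \<Rightarrow> bool" where
  "collision_monotone \<phi> \<longleftrightarrow> (\<forall>i\<ge>2. \<phi> i = \<phi> 2) \<and>
     (\<forall>j\<ge>1. \<forall>k\<ge>1. \<phi> j + \<phi> k \<le> (\<Sum>i = 1..j + k - 1. \<phi> i * B j k i))"

lemma net_collision_monotone:
  assumes "collision_monotone \<phi>" "\<And>i. 0 \<le> w i"
  shows "0 \<le> (\<Sum>i = 1..N. \<phi> i * net N w i)"
proof -
  have "0 \<le> (\<Sum>i = 1..N. \<phi> i * trunc N j k i) - \<phi> j - \<phi> k" if jk: "j \<in> {1..N}" "k \<in> {1..N}" for j k
  proof (cases "j + k \<le> N + 1")
    case True
    then show ?thesis using jk assms(1) unfolding sum_trunc[OF jk] collision_monotone_def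
      by (simp add: algebra_simps)
  next
    case False
    then have "2 \<le> j" "2 \<le> k" "2 \<le> (j + k) div 2" "2 \<le> j + k - (j + k) div 2"
      using jk by auto
    moreover have "\<phi> i = \<phi> 2" if "2 \<le> i" for i
      using that assms(1) unfolding collision_monotone_def by blast
    ultimately have "\<phi> j = \<phi> 2" "\<phi> k = \<phi> 2" "\<phi> ((j + k) div 2) = \<phi> 2" "\<phi> (j + k - (j + k) div 2) = \<phi> 2"
      by blast+
    then show ?thesis using False unfolding sum_trunc[OF jk] by simp
  qed
  then show ?thesis
    unfolding sum_net_weak using assms(2)
    by (intro mult_nonneg_nonneg sum_nonneg) (auto intro: kernel_nonneg)
qed

text \<open>
  Steady states of the truncated system with a relaxation of rate \<open>\<delta>\<close> towards the target state \<open>v\<close>.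
\<close>

definition relaxed_steady :: "nat \<Rightarrow> real \<Rightarrow> (nat \<Rightarrow> real) \<Rightarrow> (nat \<Rightarrow> real) \<Rightarrow> bool" where
  "relaxed_steady N \<delta> v w \<longleftrightarrow> (\<forall>i\<in>{1..N}. net N w i + \<delta> * (v i - w i) = 0)"

lemma relaxed_steady_sum:
  assumes "relaxed_steady N \<delta> v w"
  shows "(\<Sum>i = 1..N. \<phi> i * net N w i) = \<delta> * ((\<Sum>i = 1..N. \<phi> i * w i) - (\<Sum>i = 1..N. \<phi> i * v i))"
proof -
  have "net N w i = \<delta> * (w i - v i)" if "i \<in> {1..N}" for i
    using assms that unfolding relaxed_steady_def by (force simp: algebra_simps)
  then have "(\<Sum>i = 1..N. \<phi> i * net N w i) = (\<Sum>i = 1..N. \<phi> i * (\<delta> * (w i - v i)))"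
    by simp
  then show ?thesis
    by (simp add: sum_distrib_left sum_subtractf[symmetric] algebra_simps)
qed

text \<open>
  At a relaxed steady state production of \<open>\<phi>\<close> by collisions is balanced by relaxation, so a quantity that
  collisions do not decrease cannot lie below its target value. The bound does not depend on \<open>\<delta>\<close> and survives \<open>\<delta> \<rightarrow> 0\<close>.
\<close>

lemma relaxed_steady_monotone:
  assumes "relaxed_steady N \<delta> v w" "0 < \<delta>" "collision_monotone \<phi>" "\<And>i. 0 \<le> w i"
  shows "(\<Sum>i = 1..N. \<phi> i * v i) \<le> (\<Sum>i = 1..N. \<phi> i * w i)"
  using net_collision_monotone[of \<phi> w N] assms
  unfolding relaxed_steady_sum[OF assms(1)] by (simp add: zero_le_mult_iff)

text \<open>
  A steady state is a fixed point of an Euler step \<open>h\<close>. Collisions conserve mass, and so does the relaxation since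
  \<open>v\<close> has the mass of \<open>w\<close>. Negative contributions to component \<open>i\<close> are proportional to \<open>w i\<close>, hence the
  step preserves positivity once \<open>h\<close> times the total loss rate is at most \<open>1\<close>.
\<close>

lemma relaxed_steady_exists:
  assumes "1 \<le> N" "0 < \<rho>" "v \<in> mass_simplex N \<rho>" "0 < \<delta>" "\<delta> \<le> 1"
  shows "\<exists>w\<in>mass_simplex N \<rho>. relaxed_steady N \<delta> v w"
proof -
  \<comment> \<open>bounds the loss rate of every size on the whole simplex\<close>
  define \<Lambda> where "\<Lambda> = (\<Sum>i = 1..N. \<Sum>j = 1..N. a i j * \<rho>)"
  define h where "h = 1 / (\<Lambda> + 1)"
  have "0 \<le> \<Lambda>" unfolding \<Lambda>_def using \<open>0 < \<rho>\<close>
    by (intro sum_nonneg mult_nonneg_nonneg) (auto intro: kernel_nonneg)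
  then have "0 < h" by (simp add: h_def)
  define f where "f w i = (if i \<in> {1..N} then w i + h * (net N w i + \<delta> * (v i - w i)) else 0)" for w i
  have "\<exists>w\<in>mass_simplex N \<rho>. f w = w"
  proof (rule mass_simplex_fixed_point)
    fix w assume w: "w \<in> mass_simplex N \<rho>"
    have w0: "0 \<le> w i" and v0: "0 \<le> v i" for i
      using w assms(3) by (auto simp: mass_simplex_def)
    have "0 \<le> f w i" for i
    proof (cases "i \<in> {1..N}")
      case True
      have "(\<Sum>j = 1..N. a i j * w j) \<le> (\<Sum>j = 1..N. a i j * \<rho>)"
        using True mass_simplex_le[OF w] by (intro sum_mono mult_left_mono) (auto intro: kernel_nonneg)
      also have "\<dots> \<le> \<Lambda>"
        unfolding \<Lambda>_def using True \<open>0 < \<rho>\<close>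
        by (intro member_le_sum[of i _ "\<lambda>i. \<Sum>j = 1..N. a i j * \<rho>"] sum_nonneg)
           (auto intro!: mult_nonneg_nonneg kernel_nonneg)
      finally have "h * ((\<Sum>j = 1..N. a i j * w j) + \<delta>) \<le> h * (\<Lambda> + 1)"
        using \<open>0 < h\<close> \<open>\<delta> \<le> 1\<close> by (intro mult_left_mono) auto
      also have "\<dots> = 1" using \<open>0 \<le> \<Lambda>\<close> by (simp add: h_def)
      finally have "0 \<le> w i * (1 - h * ((\<Sum>j = 1..N. a i j * w j) + \<delta>))"
        using w0 by simp
      moreover have "0 \<le> h * (1 / 2 * (\<Sum>j = 1..N. \<Sum>k = 1..N. trunc N j k i * a j k * w j * w k) + \<delta> * v i)"
        using \<open>0 < h\<close> \<open>0 < \<delta>\<close> w0 v0 True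
        by (intro mult_nonneg_nonneg add_nonneg_nonneg sum_nonneg)
           (auto intro: kernel_nonneg trunc_nonneg)
      moreover have "f w i = w i * (1 - h * ((\<Sum>j = 1..N. a i j * w j) + \<delta>)) +
         h * (1 / 2 * (\<Sum>j = 1..N. \<Sum>k = 1..N. trunc N j k i * a j k * w j * w k) + \<delta> * v i)"
        using True by (simp add: f_def net_def algebra_simps sum_distrib_left)
      ultimately show ?thesis by simp
    qed (auto simp: f_def)
    moreover have "(\<Sum>i = 1..N. real i * f w i) = \<rho>"
    proof -
      have "(\<Sum>i = 1..N. real i * f w i) = (\<Sum>i = 1..N. real i * w i) + h * (\<Sum>i = 1..N. real i * net N w i)
         + h * \<delta> * ((\<Sum>i = 1..N. real i * v i) - (\<Sum>i = 1..N. real i * w i))"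
        by (simp add: f_def algebra_simps sum.distrib sum_distrib_left sum_subtractf)
      then show ?thesis using w assms(3) unfolding net_mass by (simp add: mass_simplex_def)
    qed
    ultimately show "f w \<in> mass_simplex N \<rho>"
      by (auto simp: mass_simplex_def f_def)
  next
    fix i
    have c: "continuous_on (mass_simplex N \<rho>) (\<lambda>w. w i)" for i :: nat
      by (rule continuous_on_subset[OF continuous_on_product_coordinates subset_UNIV])
    show "continuous_on (mass_simplex N \<rho>) (\<lambda>w. f w i)"
      unfolding f_def net_def
      by (cases "i \<in> {1..N}"; simp only: if_True if_False) (intro continuous_intros c)+
  qed fact+
  then obtain w where w: "w \<in> mass_simplex N \<rho>" "f w = w" by blast
  have "net N w i + \<delta> * (v i - w i) = 0" if "i \<in> {1..N}" for i
    using fun_cong[OF w(2), of i] that \<open>0 < h\<close> by (simp add: f_def)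
  with w(1) show ?thesis unfolding relaxed_steady_def by blast
qed

end

section \<open>Power inequalities and the kernel\<close>

text \<open>
  Convexity: on \<open>[0, 1]\<close> the function lies below its chord.
\<close>

lemma powr_one_plus_le:
  fixes x m :: real
  assumes "0 \<le> x" "x \<le> 1" "1 \<le> m"
  shows "(1 + 2 * x) powr m \<le> 1 + 3 powr m * x"
proof -
  have "((1 - x) *\<^sub>R 1 + x *\<^sub>R 3) powr m \<le> (1 - x) * 1 powr m + x * 3 powr m"
    using assms by (intro convex_onD[OF powr_convex]) auto
  then show ?thesis using assms by (simp add: algebra_simps)
qed

text \<open>
  Both members of a balanced pair are at most half of the larger cluster plus the smaller one. To
  leading order their moments sum up to at most half of the moment of the larger cluster, and the
  correction is a cross term, so balanced pairs satisfy an inequality of the form (B2) with \<open>\<epsilon> = 1 / 2\<close>.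
\<close>

lemma balanced_pair_powr_le:
  fixes m x y p q :: real
  assumes "2 \<le> m" "0 < x" "0 < y" "0 < p" "0 < q"
    and "2 * p \<le> max x y + 2 * min x y" "2 * q \<le> max x y + 2 * min x y"
  shows "p powr m + q powr m \<le>
     (1 - 1 / 2) * (x powr m + y powr m) + 3 powr m * (x * y powr (m - 1) + x powr (m - 1) * y)"
proof -
  have *: "p powr m + q powr m \<le>
     (1 - 1 / 2) * (x powr m + y powr m) + 3 powr m * (x * y powr (m - 1) + x powr (m - 1) * y)"
    if "0 < y" "y \<le> x" "2 * p \<le> x + 2 * y" "2 * q \<le> x + 2 * y" for x y
  proof -
    have half: "r powr m \<le> 1 / 4 * (x powr m + 3 powr m * (x powr (m - 1) * y))"
      if "0 < r" "2 * r \<le> x + 2 * y" for r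
    proof -
      have x: "0 < x" using \<open>0 < y\<close> \<open>y \<le> x\<close> by simp
      have "r powr m \<le> (1 / 2 * (x * (1 + 2 * (y / x)))) powr m"
        using that x \<open>2 \<le> m\<close> by (intro powr_mono2) (auto simp: algebra_simps)
      also have "\<dots> = (1 / 2) powr m * (x powr m * (1 + 2 * (y / x)) powr m)"
        using x \<open>0 < y\<close> by (subst powr_mult; simp add: powr_mult)
      also have "\<dots> \<le> (1 / 2) powr 2 * (x powr m * (1 + 3 powr m * (y / x)))"
        using x \<open>0 < y\<close> \<open>y \<le> x\<close> \<open>2 \<le> m\<close>
        by (intro mult_mono powr_mono' mult_left_mono powr_one_plus_le) auto
      also have "(1 / 2 :: real) powr 2 = 1 / 4" by (simp add: power2_eq_square)
      also have "x powr m * (1 + 3 powr m * (y / x)) = x powr m + 3 powr m * (x powr (m - 1) * y)"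
        using x by (simp add: powr_diff field_simps)
      finally show ?thesis .
    qed
    have "p powr m + q powr m \<le> 1 / 2 * (x powr m + 3 powr m * (x powr (m - 1) * y))"
      using half[of p] half[of q] that assms by linarith
    also have "\<dots> \<le> 1 / 2 * (x powr m + y powr m) + 3 powr m * (x * y powr (m - 1) + x powr (m - 1) * y)"
      using that by (simp add: distrib_left)
    finally show ?thesis by simp
  qed
  show ?thesis
  proof (cases "y \<le> x")
    case True
    then show ?thesis using *[of y x] assms by (simp add: max_absorb1 min_absorb2)
  next
    case False
    then show ?thesis using *[of x y] assms by (simp add: max_absorb2 min_absorb1 add.commute mult.commute)
  qed
qed

text \<open>
  The terms on the right take turns: the first one suffices beyond the point where \<open>x powr (s - t) = \<eta>\<close>, and
  up to there the second one does, being the value of \<open>x powr s\<close> at that point.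
\<close>

lemma powr_absorb:
  fixes s t \<eta> x :: real
  assumes "0 \<le> s" "s < t" "0 < \<eta>" "0 < x"
  shows "x powr s \<le> \<eta> * x powr t + \<eta> powr (s / (s - t))"
proof (cases "x powr (s - t) \<le> \<eta>")
  case True
  have "x powr s = x powr (s - t) * x powr t"
    by (simp flip: powr_add)
  also have "\<dots> \<le> \<eta> * x powr t"
    using True by (intro mult_right_mono) auto
  also have "\<dots> \<le> \<eta> * x powr t + \<eta> powr (s / (s - t))" by simp
  finally show ?thesis .
next
  case False
  have "x powr s = (x powr (s - t)) powr (s / (s - t))"
    using assms by (simp add: powr_powr)
  also have "\<dots> \<le> \<eta> powr (s / (s - t))"
    using False assms by (intro powr_mono2') (auto simp: divide_nonneg_neg)
  also have "\<dots> \<le> \<eta> * x powr t + \<eta> powr (s / (s - t))"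
    using assms by simp
  finally show ?thesis .
qed

lemma powr_mult_le_max:
  fixes x y r s u :: real
  assumes "1 \<le> x" "1 \<le> y" "r \<le> u" "0 \<le> u" "s \<le> t" "0 \<le> t"
  shows "x powr r * y powr s \<le> max x y powr (u + t)"
proof -
  have "x powr r \<le> x powr u" "y powr s \<le> y powr t"
    using assms by (auto intro: powr_mono)
  moreover have "x powr u \<le> max x y powr u" "y powr t \<le> max x y powr t"
    using assms by (auto intro!: powr_mono2)
  ultimately have "x powr r * y powr s \<le> max x y powr u * max x y powr t"
    by (intro mult_mono) auto
  then show ?thesis by (simp add: powr_add)
qed

context breakage
begin

lemma trunc_moment:
  assumes "2 \<le> m"
  shows "\<exists>\<epsilon> \<kappa>. 0 < \<epsilon> \<and> 0 < \<kappa> \<and> (\<forall>N. \<forall>j\<in>{1..N}. \<forall>k\<in>{1..N}.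
     (\<Sum>i = 1..N. real i powr m * trunc N j k i) \<le> (1 - \<epsilon>) * (real j powr m + real k powr m)
       + \<kappa> * (real j * real k powr (m - 1) + real j powr (m - 1) * real k))"
proof -
  from assms have "m > 1" by simp
  from B2[unfolded condB2_def, rule_format, OF this]
  obtain \<epsilon> \<kappa> where \<epsilon>: "0 < \<epsilon>" "\<epsilon> < 1" and \<kappa>: "1 \<le> \<kappa>" and
    bound: "\<And>j k. 1 \<le> j \<Longrightarrow> 1 \<le> k \<Longrightarrow> (\<Sum>i = 1..j + k - 1. real i powr m * B j k i)
      \<le> (1 - \<epsilon>) * (real j powr m + real k powr m)
        + \<kappa> * (real j * real k powr (m - 1) + real j powr (m - 1) * real k)"
    by blast
  define \<epsilon>' \<kappa>' where "\<epsilon>' = min \<epsilon> (1 / 2)" and "\<kappa>' = max \<kappa> (3 powr m)"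
  have "(\<Sum>i = 1..N. real i powr m * trunc N j k i) \<le> (1 - \<epsilon>') * (real j powr m + real k powr m)
       + \<kappa>' * (real j * real k powr (m - 1) + real j powr (m - 1) * real k)"
    if jk: "j \<in> {1..N}" "k \<in> {1..N}" for N j k
  proof (cases "j + k \<le> N + 1")
    case True
    then have "(\<Sum>i = 1..N. real i powr m * trunc N j k i) \<le> (1 - \<epsilon>) * (real j powr m + real k powr m)
        + \<kappa> * (real j * real k powr (m - 1) + real j powr (m - 1) * real k)"
      unfolding sum_trunc[OF jk] using bound jk by simp
    also have "\<dots> \<le> (1 - \<epsilon>') * (real j powr m + real k powr m)
       + \<kappa>' * (real j * real k powr (m - 1) + real j powr (m - 1) * real k)"
      by (intro add_mono mult_right_mono) (auto simp: \<epsilon>'_def \<kappa>'_def)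
    finally show ?thesis .
  next
    case False
    define p where "p = (j + k) div 2"
    have "(\<Sum>i = 1..N. real i powr m * trunc N j k i) = real p powr m + real (j + k - p) powr m"
      unfolding sum_trunc[OF jk] p_def using False by simp
    also have "\<dots> \<le> (1 - 1 / 2) * (real j powr m + real k powr m)
        + 3 powr m * (real j * real k powr (m - 1) + real j powr (m - 1) * real k)"
    proof (rule balanced_pair_powr_le)
      have "2 * p \<le> max j k + 2 * min j k" "2 * (j + k - p) \<le> max j k + 2 * min j k"
        using jk by (auto simp: p_def)
      then show "2 * real p \<le> max (real j) (real k) + 2 * min (real j) (real k)"
        "2 * real (j + k - p) \<le> max (real j) (real k) + 2 * min (real j) (real k)"
        unfolding of_nat_max[symmetric] of_nat_min[symmetric] by linarith+
    qed (use jk \<open>2 \<le> m\<close> in \<open>auto simp: p_def\<close>)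
    also have "\<dots> \<le> (1 - \<epsilon>') * (real j powr m + real k powr m)
       + \<kappa>' * (real j * real k powr (m - 1) + real j powr (m - 1) * real k)"
      by (intro add_mono mult_right_mono) (auto simp: \<epsilon>'_def \<kappa>'_def)
    finally show ?thesis .
  qed
  moreover have "0 < \<epsilon>'" "0 < \<kappa>'" using \<epsilon> \<kappa> by (auto simp: \<epsilon>'_def \<kappa>'_def)
  ultimately show ?thesis by blast
qed

text \<open>
  Only the products with the exponent \<open>m + \<beta>\<close> are kept; they carry the moment that has to absorb the cross terms.
\<close>

lemma kernel_coercive:
  assumes "1 \<le> j" "1 \<le> k"
  shows "A * (real j powr (m + \<beta>) * real k powr \<alpha> + real j powr \<alpha> * real k powr (m + \<beta>))
    \<le> a j k * (real j powr m + real k powr m)"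
proof -
  have "a j k * (real j powr m + real k powr m)
      = A * (real j powr (m + \<beta>) * real k powr \<alpha> + real j powr \<alpha> * real k powr (m + \<beta>))
      + A * (real j powr (m + \<alpha>) * real k powr \<beta> + real j powr \<beta> * real k powr (m + \<alpha>))"
    using assms by (simp add: kernel powr_add algebra_simps)
  then show ?thesis using A by simp
qed

text \<open>
  This is where \<open>\<alpha> < 1\<close> matters: apart from the factor \<open>j k\<close>, the cross terms grow at most like the power \<open>s\<close> of the
  larger size, and \<open>s < t\<close>.
\<close>

lemma kernel_cross:
  assumes "1 \<le> j" "1 \<le> k" "2 \<le> m" "0 < \<eta>"
  defines "s \<equiv> max \<alpha> 0 + (m - 2 + \<beta>)" and "t \<equiv> m - 1 + \<beta>"
  shows "a j k * (real j * real k powr (m - 1) + real j powr (m - 1) * real k)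
    \<le> 4 * A * (\<eta> * (real j powr (m + \<beta>) * real k + real j * real k powr (m + \<beta>))
               + \<eta> powr (s / (s - t)) * (real j * real k))"
proof -
  define M where "M = max (real j) (real k)"
  have x: "1 \<le> real j" "1 \<le> real k" using assms by auto
  have split: "u powr (m - 1) = u * u powr (m - 2)" if "1 \<le> u" for u :: real
    using that powr_add[of u 1 "m - 2"] by simp
  have t: "m + \<beta> = 1 + t" by (simp add: t_def)
  have "s < t" "0 \<le> s" using \<alpha>\<beta> \<open>2 \<le> m\<close> by (auto simp: s_def t_def)
  have e: "real j powr \<alpha> * real k powr (m - 2 + \<beta>) \<le> M powr s"
    "real k powr \<alpha> * real j powr (m - 2 + \<beta>) \<le> M powr s"
  proof -
    have *: "u powr \<alpha> * v powr (m - 2 + \<beta>) \<le> max u v powr s" if "1 \<le> u" "1 \<le> v" for u v :: real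
      using powr_mult_le_max[of u v \<alpha> "max \<alpha> 0" "m - 2 + \<beta>" "m - 2 + \<beta>"] that \<alpha>\<beta> \<open>2 \<le> m\<close>
      by (simp add: s_def)
    show "real j powr \<alpha> * real k powr (m - 2 + \<beta>) \<le> M powr s"
      "real k powr \<alpha> * real j powr (m - 2 + \<beta>) \<le> M powr s"
      using *[of "real j" "real k"] *[of "real k" "real j"] x by (auto simp: M_def max.commute)
  qed
  have f: "real j powr \<beta> * real k powr (m - 2 + \<alpha>) \<le> M powr s"
    "real k powr \<beta> * real j powr (m - 2 + \<alpha>) \<le> M powr s"
  proof -
    have *: "u powr \<beta> * v powr (m - 2 + \<alpha>) \<le> max u v powr s" if "1 \<le> u" "1 \<le> v" for u v :: real
      using powr_mult_le_max[of u v \<beta> \<beta> "m - 2 + \<alpha>" "m - 2 + max \<alpha> 0"] that \<alpha>\<beta> \<open>2 \<le> m\<close>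
      by (simp add: s_def add_ac)
    show "real j powr \<beta> * real k powr (m - 2 + \<alpha>) \<le> M powr s"
      "real k powr \<beta> * real j powr (m - 2 + \<alpha>) \<le> M powr s"
      using *[of "real j" "real k"] *[of "real k" "real j"] x by (auto simp: M_def max.commute)
  qed
  have "a j k * (real j * real k powr (m - 1) + real j powr (m - 1) * real k)
     = A * (real j * real k) * ((real j powr \<alpha> * real k powr (m - 2 + \<beta>) + real k powr \<alpha> * real j powr (m - 2 + \<beta>))
       + (real j powr \<beta> * real k powr (m - 2 + \<alpha>) + real k powr \<beta> * real j powr (m - 2 + \<alpha>)))"
    unfolding kernel[OF assms(1,2)] split[OF x(1)] split[OF x(2)] powr_add[of _ "m - 2"]
    by (simp add: algebra_simps)
  also have "\<dots> \<le> A * (real j * real k) * (4 * M powr s)"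
    using A e f by (intro mult_left_mono) auto
  also have "\<dots> \<le> A * (real j * real k) * (4 * (\<eta> * (real j powr t + real k powr t) + \<eta> powr (s / (s - t))))"
  proof -
    have "M powr s \<le> \<eta> * M powr t + \<eta> powr (s / (s - t))"
      using \<open>0 \<le> s\<close> \<open>s < t\<close> \<open>0 < \<eta>\<close> x by (intro powr_absorb) (auto simp: M_def)
    also have "M powr t \<le> real j powr t + real k powr t"
      by (auto simp: M_def max_def)
    finally show ?thesis using A \<open>0 < \<eta>\<close> by (intro mult_left_mono) auto
  qed
  also have "\<dots> = 4 * A * (\<eta> * (real j powr (m + \<beta>) * real k + real j * real k powr (m + \<beta>))
               + \<eta> powr (s / (s - t)) * (real j * real k))"
    unfolding t powr_add using x by (simp add: algebra_simps)
  finally show ?thesis .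
qed

text \<open>
  For negative \<open>\<alpha>\<close> the moment could be small only if the clusters were large, which the mass excludes: at
  most half of the number can sit at sizes beyond \<open>2 \<rho> / n\<close>. The pointwise lower bound by a
  linear function of the size makes this quantitative without splitting the sum.
\<close>

lemma sum_powr_lower:
  assumes w: "\<And>i. 0 \<le> w i" and "0 < n" "0 < \<rho>"
    and "(\<Sum>i = 1..N. real i * w i) = \<rho>" "n \<le> (\<Sum>i = 1..N. w i)"
  shows "(2 * \<rho> / n) powr (min \<alpha> 0) * (n / 2) \<le> (\<Sum>i = 1..N. real i powr \<alpha> * w i)"
proof -
  define L where "L = 2 * \<rho> / n"
  have "0 < L" using assms by (simp add: L_def)
  have pt: "L powr (min \<alpha> 0) * (1 - real i / L) \<le> real i powr \<alpha>" if "i \<in> {1..N}" for i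
  proof (cases "real i \<le> L")
    case True
    have "L powr (min \<alpha> 0) * (1 - real i / L) \<le> L powr (min \<alpha> 0) * 1"
      using \<open>0 < L\<close> by (intro mult_left_mono) auto
    also have "\<dots> \<le> real i powr (min \<alpha> 0)"
      using True that by (auto intro!: powr_mono2')
    also have "\<dots> \<le> real i powr \<alpha>"
      using that by (intro powr_mono) auto
    finally show ?thesis .
  next
    case False
    then have "L powr (min \<alpha> 0) * (1 - real i / L) \<le> 0"
      using \<open>0 < L\<close> by (intro mult_nonneg_nonpos) (auto simp: field_simps)
    also have "0 \<le> real i powr \<alpha>" by simp
    finally show ?thesis .
  qed
  have "L powr (min \<alpha> 0) * (n / 2) \<le> L powr (min \<alpha> 0) * ((\<Sum>i = 1..N. w i) - \<rho> / L)"
    using assms by (intro mult_left_mono) (auto simp: L_def)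
  also have "\<dots> = (\<Sum>i = 1..N. L powr (min \<alpha> 0) * (1 - real i / L) * w i)"
  proof -
    have "(\<Sum>i = 1..N. L powr (min \<alpha> 0) * (1 - real i / L) * w i)
      = (\<Sum>i = 1..N. L powr (min \<alpha> 0) * w i - L powr (min \<alpha> 0) / L * (real i * w i))"
      by (intro sum.cong refl) (simp add: algebra_simps)
    also have "\<dots> = L powr (min \<alpha> 0) * (\<Sum>i = 1..N. w i) - L powr (min \<alpha> 0) / L * \<rho>"
      unfolding sum_subtractf sum_distrib_left[symmetric] assms(4) ..
    finally show ?thesis by (simp add: algebra_simps)
  qed
  also have "\<dots> \<le> (\<Sum>i = 1..N. real i powr \<alpha> * w i)"
    using pt w by (intro sum_mono mult_right_mono) auto
  finally show ?thesis by (simp add: L_def)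
qed

end

section \<open>Uniform decay of relaxed steady states\<close>

context breakage begin

text \<open>
  The relaxation contributes at most the moment of \<open>v\<close>, because \<open>\<delta> \<le> 1\<close>, and so the bound is uniform in
  \<open>N\<close> and \<open>\<delta>\<close>.
\<close>

lemma relaxed_steady_moment_bound:
  assumes m: "2 \<le> m" and \<rho>: "0 < \<rho>" and v: "v \<in> mass_simplex n \<rho>" and \<nu>: "0 < \<nu>"
  shows "\<exists>K. \<forall>N\<ge>n. \<forall>\<delta> w. 0 < \<delta> \<and> \<delta> \<le> 1 \<and> w \<in> mass_simplex N \<rho> \<and> relaxed_steady N \<delta> v w \<and>
    \<nu> \<le> (\<Sum>i = 1..N. w i) \<longrightarrow> (\<Sum>i = 1..N. real i powr (m + \<beta>) * w i) \<le> K"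
proof -
  obtain \<epsilon> \<kappa> where \<epsilon>: "0 < \<epsilon>" and \<kappa>: "0 < \<kappa>" and
    frag: "\<And>N j k. j \<in> {1..N} \<Longrightarrow> k \<in> {1..N} \<Longrightarrow>
     (\<Sum>i = 1..N. real i powr m * trunc N j k i) \<le> (1 - \<epsilon>) * (real j powr m + real k powr m)
       + \<kappa> * (real j * real k powr (m - 1) + real j powr (m - 1) * real k)"
    using trunc_moment[OF m] by blast
  define c where "c = (2 * \<rho> / \<nu>) powr (min \<alpha> 0) * (\<nu> / 2)"
  have c: "0 < c" using \<rho> \<nu> by (simp add: c_def)
  \<comment> \<open>chosen so that the cross terms use up exactly half of the dissipation, see \<open>8 * \<kappa> * \<eta> * \<rho> = \<epsilon> * c\<close> below\<close>
  define \<eta> where "\<eta> = \<epsilon> * c / (8 * \<kappa> * \<rho>)"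
  have \<eta>: "0 < \<eta>" using \<epsilon> c \<kappa> \<rho> by (simp add: \<eta>_def)
  define D where "D = \<eta> powr ((max \<alpha> 0 + (m - 2 + \<beta>)) / ((max \<alpha> 0 + (m - 2 + \<beta>)) - (m - 1 + \<beta>)))"
  define W where "W = (\<Sum>i = 1..n. real i powr m * v i)"
  define K where "K = (4 * \<kappa> * A * D * \<rho>\<^sup>2 + 2 * W) / (\<epsilon> * A * c)"
  have "(\<Sum>i = 1..N. real i powr (m + \<beta>) * w i) \<le> K"
    if N: "n \<le> N" and \<delta>: "0 < \<delta>" "\<delta> \<le> 1" and w: "w \<in> mass_simplex N \<rho>"
      and steady: "relaxed_steady N \<delta> v w" and num: "\<nu> \<le> (\<Sum>i = 1..N. w i)" for N \<delta> w
  proof -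
    define X where "X = (\<Sum>i = 1..N. real i powr (m + \<beta>) * w i)"
    define Z where "Z = (\<Sum>i = 1..N. real i powr \<alpha> * w i)"
    have w0: "0 \<le> w i" for i using w by (simp add: mass_simplex_def)
    have mass: "(\<Sum>i = 1..N. real i * w i) = \<rho>" using w by (simp add: mass_simplex_def)
    have X: "0 \<le> X" unfolding X_def using w0 by (intro sum_nonneg) auto
    have Z: "c \<le> Z" unfolding c_def Z_def
      using sum_powr_lower[OF w0 \<nu> \<rho> mass num] .
    have Wv: "(\<Sum>i = 1..N. real i powr m * v i) = W"
      unfolding W_def using N v
      by (intro sum.mono_neutral_right) (auto simp: mass_simplex_def)
    have W: "0 \<le> W" unfolding W_def using v
      by (intro sum_nonneg mult_nonneg_nonneg) (auto simp: mass_simplex_def)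
    define G where "G j k = a j k * w j * w k *
        ((\<Sum>i = 1..N. real i powr m * trunc N j k i) - real j powr m - real k powr m)" for j k
    have "- W \<le> - \<delta> * W" using \<delta> W by (simp add: mult_left_le_one_le)
    also have "\<dots> \<le> \<delta> * ((\<Sum>i = 1..N. real i powr m * w i) - W)"
    proof -
      have "0 \<le> (\<Sum>i = 1..N. real i powr m * w i)"
        using w0 by (intro sum_nonneg) auto
      then show ?thesis using \<delta> by (simp add: algebra_simps)
    qed
    also have "\<dots> = 1 / 2 * (\<Sum>j = 1..N. \<Sum>k = 1..N. G j k)"
      unfolding G_def sum_net_weak[symmetric] relaxed_steady_sum[OF steady] Wv ..
    finally have lower: "- 2 * W \<le> (\<Sum>j = 1..N. \<Sum>k = 1..N. G j k)" by simp
    define P where "P j k = (- (\<epsilon> * A)) *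
        ((real j powr (m + \<beta>) * w j) * (real k powr \<alpha> * w k) + (real j powr \<alpha> * w j) * (real k powr (m + \<beta>) * w k))
       + 4 * \<kappa> * A * (\<eta> * ((real j powr (m + \<beta>) * w j) * (real k * w k) + (real j * w j) * (real k powr (m + \<beta>) * w k))
         + D * ((real j * w j) * (real k * w k)))" for j k
    have "G j k \<le> P j k" if jk: "j \<in> {1..N}" "k \<in> {1..N}" for j k
    proof -
      have j: "1 \<le> j" and k: "1 \<le> k" using jk by auto
      let ?J = "real j powr m + real k powr m"
      let ?X = "real j * real k powr (m - 1) + real j powr (m - 1) * real k"
      have "a j k * ((\<Sum>i = 1..N. real i powr m * trunc N j k i) - real j powr m - real k powr m)
          \<le> a j k * (- \<epsilon> * ?J + \<kappa> * ?X)"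
        using frag[OF jk] kernel_nonneg[OF j k] by (intro mult_left_mono) (auto simp: algebra_simps)
      also have "\<dots> = - \<epsilon> * (a j k * ?J) + \<kappa> * (a j k * ?X)"
        by (simp add: algebra_simps)
      also have "\<dots> \<le> - \<epsilon> * (A * (real j powr (m + \<beta>) * real k powr \<alpha> + real j powr \<alpha> * real k powr (m + \<beta>)))
          + \<kappa> * (4 * A * (\<eta> * (real j powr (m + \<beta>) * real k + real j * real k powr (m + \<beta>)) + D * (real j * real k)))"
        unfolding D_def using kernel_coercive[OF j k, of m] kernel_cross[OF j k m \<eta>] \<epsilon> \<kappa>
        by (intro add_mono mult_left_mono mult_left_mono_neg) auto
      finally have "(w j * w k) * (a j k * ((\<Sum>i = 1..N. real i powr m * trunc N j k i) - real j powr m - real k powr m))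
        \<le> (w j * w k) * (- \<epsilon> * (A * (real j powr (m + \<beta>) * real k powr \<alpha> + real j powr \<alpha> * real k powr (m + \<beta>)))
          + \<kappa> * (4 * A * (\<eta> * (real j powr (m + \<beta>) * real k + real j * real k powr (m + \<beta>)) + D * (real j * real k))))"
        using w0 by (intro mult_left_mono) auto
      then show ?thesis unfolding G_def P_def by (simp add: algebra_simps)
    qed
    then have "(\<Sum>j = 1..N. \<Sum>k = 1..N. G j k) \<le> (\<Sum>j = 1..N. \<Sum>k = 1..N. P j k)"
      by (intro sum_mono)
    also have "\<dots> = (- (\<epsilon> * A)) * (X * Z + Z * X) + 4 * \<kappa> * A * (\<eta> * (X * \<rho> + \<rho> * X) + D * (\<rho> * \<rho>))"
      unfolding P_def sum.distrib sum_distrib_left[symmetric] sum_distrib_right[symmetric] mass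
      by (simp only: X_def Z_def)
    finally have "2 * (\<epsilon> * A * X * Z) \<le> 8 * \<kappa> * \<eta> * \<rho> * (A * X) + (4 * \<kappa> * A * D * \<rho>\<^sup>2 + 2 * W)"
      using lower by (simp add: algebra_simps power2_eq_square)
    moreover have "8 * \<kappa> * \<eta> * \<rho> = \<epsilon> * c"
      using \<kappa> \<rho> by (simp add: \<eta>_def)
    moreover have "\<epsilon> * A * X * c \<le> \<epsilon> * A * X * Z"
      using X Z \<epsilon> A by (intro mult_left_mono) auto
    ultimately have "X * (\<epsilon> * A * c) \<le> 4 * \<kappa> * A * D * \<rho>\<^sup>2 + 2 * W"
      by (simp add: mult_ac)
    then have "X \<le> K" unfolding K_def using \<epsilon> A c by (simp add: pos_le_divide_eq)
    then show ?thesis by (simp add: X_def)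
  qed
  then show ?thesis by blast
qed

lemma relaxed_steady_decay:
  assumes \<rho>: "0 < \<rho>" and v: "v \<in> mass_simplex n \<rho>" and \<nu>: "0 < \<nu>"
  shows "\<exists>K\<ge>0. \<forall>N\<ge>n. \<forall>\<delta> w i. 0 < \<delta> \<and> \<delta> \<le> 1 \<and> w \<in> mass_simplex N \<rho> \<and> relaxed_steady N \<delta> v w \<and>
    \<nu> \<le> (\<Sum>i = 1..N. w i) \<longrightarrow> w i \<le> K * real i powr (- r)"
proof -
  define m where "m = max 2 r"
  have m: "2 \<le> m" "r \<le> m + \<beta>" using \<alpha>\<beta> by (auto simp: m_def)
  obtain K where K: "\<And>N \<delta> w. n \<le> N \<Longrightarrow> 0 < \<delta> \<and> \<delta> \<le> 1 \<and> w \<in> mass_simplex N \<rho> \<and> relaxed_steady N \<delta> v w \<and>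
    \<nu> \<le> (\<Sum>i = 1..N. w i) \<Longrightarrow> (\<Sum>i = 1..N. real i powr (m + \<beta>) * w i) \<le> K"
    using relaxed_steady_moment_bound[OF m(1) \<rho> v \<nu>] by blast
  have "w i \<le> max K 0 * real i powr (- r)"
    if "n \<le> N" and hyp: "0 < \<delta> \<and> \<delta> \<le> 1 \<and> w \<in> mass_simplex N \<rho> \<and> relaxed_steady N \<delta> v w \<and>
      \<nu> \<le> (\<Sum>i = 1..N. w i)" for N \<delta> w i
  proof (cases "i \<in> {1..N}")
    case True
    have w0: "0 \<le> w i" for i using hyp by (simp add: mass_simplex_def)
    have "real i powr r * w i \<le> real i powr (m + \<beta>) * w i"
      using True m w0 by (intro mult_right_mono powr_mono) auto
    also have "\<dots> \<le> (\<Sum>i = 1..N. real i powr (m + \<beta>) * w i)"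
      using True w0 by (intro member_le_sum[of i _ "\<lambda>i. real i powr (m + \<beta>) * w i"]) auto
    also have "\<dots> \<le> max K 0" using K[OF that] by simp
    finally have "real i powr (- r) * (real i powr r * w i) \<le> real i powr (- r) * max K 0"
      by (intro mult_left_mono) auto
    then show ?thesis using True by (simp add: powr_minus mult_ac)
  next
    case False
    then have "w i = 0" using hyp by (simp add: mass_simplex_def)
    then show ?thesis by simp
  qed
  then show ?thesis by (intro exI[of _ "max K 0"]) auto
qed

end

section \<open>Passage to the limit\<close>

lemma suminf_tendsto_of_decay:
  fixes x :: "nat \<Rightarrow> nat \<Rightarrow> real"
  assumes lim: "\<And>i. (\<lambda>k. x k i) \<longlonglongrightarrow> z i"
    and bound: "\<And>k i. \<bar>x k i\<bar> \<le> K * real i powr (- 2)"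
  shows "summable z" "(\<lambda>k. \<Sum>i. x k i) \<longlonglongrightarrow> (\<Sum>i. z i)"
proof -
  have M: "summable (\<lambda>i. K * real i powr (- 2))"
    by (intro summable_mult) (simp add: summable_real_powr_iff)
  have "eventually (\<lambda>(i, k). norm (x k i) \<le> K * real i powr (- 2)) (at_top \<times>\<^sub>F sequentially)"
    using bound by (intro always_eventually) auto
  note T = tannerys_theorem[OF lim this M sequentially_bot]
  from T show "summable z" by (auto intro: summable_norm_cancel)
  from T show "(\<lambda>k. \<Sum>i. x k i) \<longlonglongrightarrow> (\<Sum>i. z i)" by blast
qed

text \<open>
  The equation sums the gain over \<open>s = j + k\<close> first, whereas the weak form wants the square \<open>{1..N} \<times> {1..N}\<close>.
\<close>

lemma double_sum_by_diagonals:
  fixes f :: "nat \<Rightarrow> nat \<Rightarrow> real"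
  assumes "\<And>j k. j \<notin> {1..N} \<or> k \<notin> {1..N} \<Longrightarrow> f j k = 0"
  shows "(\<Sum>j = 1..N. \<Sum>k = 1..N. f j k) = (\<Sum>s. \<Sum>k = 1..s - 1. f (s - k) k)"
proof -
  have "(\<Sum>s. \<Sum>k = 1..s - 1. f (s - k) k) = (\<Sum>s = 0..2 * N. \<Sum>k = 1..s - 1. f (s - k) k)"
    by (rule suminf_finite) (auto intro!: sum.neutral assms)
  also have "\<dots> = (\<Sum>(s, k)\<in>(SIGMA s:{0..2 * N}. {1..s - 1}). f (s - k) k)"
    by (subst sum.Sigma) auto
  also have "\<dots> = (\<Sum>(j, k)\<in>{1..N} \<times> {1..N}. f j k)"
  proof (rule sum.reindex_bij_witness_not_neutral[of
      "{(s, k) \<in> (SIGMA s:{0..2 * N}. {1..s - 1}). s - k > N \<or> k > N}" "{}"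
      _ "\<lambda>(j, k). (j + k, k)" "\<lambda>(s, k). (s - k, k)"])
    show "finite {(s, k) \<in> (SIGMA s:{0..2 * N}. {1..s - 1}). s - k > N \<or> k > N}"
      by (rule finite_subset[of _ "SIGMA s:{0..2 * N}. {1..s - 1}"]) auto
  qed (auto intro!: assms)
  also have "\<dots> = (\<Sum>j = 1..N. \<Sum>k = 1..N. f j k)"
    by (simp add: sum.cartesian_product)
  finally show ?thesis by simp
qed

lemma mass_simplex_mono:
  assumes "v \<in> mass_simplex n \<rho>" "n \<le> N"
  shows "v \<in> mass_simplex N \<rho>"
proof -
  have "(\<Sum>i = 1..N. real i * v i) = (\<Sum>i = 1..n. real i * v i)"
    using assms by (intro sum.mono_neutral_right) (auto simp: mass_simplex_def)
  then show ?thesis using assms by (auto simp: mass_simplex_def)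
qed

context breakage begin

lemma trunc_le:
  assumes "1 \<le> j" "1 \<le> k" "1 \<le> i"
  shows "trunc N j k i \<le> real (j + k)"
proof (cases "j + k \<le> N + 1")
  case True
  have "B j k i \<le> real (j + k)"
  proof (cases "j + k \<le> i")
    case False
    have "1 * B j k i \<le> real i * B j k i"
      using assms B_nonneg by (intro mult_right_mono) auto
    also have "\<dots> \<le> (\<Sum>i = 1..j + k - 1. real i * B j k i)"
      using assms False by (intro member_le_sum) (auto intro!: mult_nonneg_nonneg B_nonneg)
    finally show ?thesis using B_mass[OF assms(1,2)] by simp
  qed (use assms in \<open>simp add: B_zero\<close>)
  then show ?thesis using True by (simp add: trunc_def)
next
  case False
  then show ?thesis using assms by (auto simp: trunc_def)
qed

lemma kernel_le:
  assumes "1 \<le> j" "1 \<le> k"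
  shows "a j k \<le> 2 * A * (real j * real k)"
proof -
  have "real j powr \<gamma> * real k powr \<gamma>' \<le> real j powr 1 * real k powr 1" if "\<gamma> \<le> 1" "\<gamma>' \<le> 1" for \<gamma> \<gamma>'
    using that assms by (intro mult_mono powr_mono) auto
  from this[of \<alpha> \<beta>] this[of \<beta> \<alpha>] have
    "real j powr \<alpha> * real k powr \<beta> + real j powr \<beta> * real k powr \<alpha> \<le> 2 * (real j * real k)"
    using \<alpha>\<beta> assms by simp
  then have "A * (real j powr \<alpha> * real k powr \<beta> + real j powr \<beta> * real k powr \<alpha>) \<le> A * (2 * (real j * real k))"
    using A by (intro mult_left_mono) auto
  then show ?thesis using assms by (simp add: kernel)
qed

text \<open>
  With decay rate \<open>5\<close>, a product of two components is of order \<open>(j k) powr (- 5)\<close>; the kernel costs one power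
  of \<open>j k \<ge> s / 2\<close>, the daughter distribution one power of \<open>s\<close>, and the length of the diagonal another.
  A summable \<open>s powr (- 2)\<close> remains.
\<close>

lemma gain_diagonal_bound:
  assumes K: "0 \<le> K" and w: "\<And>i. 0 \<le> w i" "\<And>i. w i \<le> K * real i powr (- 5)" and i: "1 \<le> i"
  shows "\<bar>\<Sum>k = 1..s - 1. trunc N (s - k) k i * a (s - k) k * w (s - k) * w k\<bar> \<le> 32 * A * K\<^sup>2 * real s powr (- 2)"
proof -
  have "\<bar>trunc N (s - k) k i * a (s - k) k * w (s - k) * w k\<bar> \<le> 32 * A * K\<^sup>2 * real s powr (- 3)"
    if k: "k \<in> {1..s - 1}" for k
  proof -
    define j where "j = s - k"
    have j: "1 \<le> j" and k1: "1 \<le> k" and s: "s = j + k" using k by (auto simp: j_def)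
    have "w j * w k \<le> (K * real j powr (- 5)) * (K * real k powr (- 5))"
      using w K by (intro mult_mono) auto
    also have "\<dots> = K\<^sup>2 * (real j * real k) powr (- 5)"
      by (simp add: powr_mult power2_eq_square)
    finally have ww: "w j * w k \<le> K\<^sup>2 * (real j * real k) powr (- 5)" .
    have js: "real s / 2 \<le> real j * real k"
    proof -
      \<comment> \<open>hence \<open>j k \<ge> j + k - 1\<close>, which is at least half of \<open>j + k\<close>\<close>
      have "0 \<le> (real j - 1) * (real k - 1)" using j k1 by simp
      then have "real s - 1 \<le> real j * real k" using s by (simp add: algebra_simps)
      moreover have "2 \<le> real s" using s j k1 by linarith
      ultimately show ?thesis by linarith
    qed
    have "trunc N j k i * a j k * w j * w k = (trunc N j k i * a j k) * (w j * w k)"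
      by simp
    also have "\<dots> \<le> (real s * (2 * A * (real j * real k))) * (K\<^sup>2 * (real j * real k) powr (- 5))"
      using w ww trunc_le[OF j k1 i] kernel_le[OF j k1] trunc_nonneg[OF j k1 i] kernel_nonneg[OF j k1] A s
      by (intro mult_mono[OF mult_mono ww]) auto
    also have "\<dots> = 2 * A * K\<^sup>2 * real s * ((real j * real k) powr 1 * (real j * real k) powr (- 5))"
      using j k1 by (simp add: mult_ac)
    also have "(real j * real k) powr 1 * (real j * real k) powr (- 5) = (real j * real k) powr (- 4)"
      by (simp only: powr_add[symmetric]) simp
    also have "2 * A * K\<^sup>2 * real s * (real j * real k) powr (- 4) \<le> 2 * A * K\<^sup>2 * real s * (real s / 2) powr (- 4)"
      using js A j s by (intro mult_left_mono powr_mono2') auto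
    also have "(real s / 2) powr (- 4) = 16 * real s powr (- 4)"
      by (simp add: powr_divide powr_minus field_simps)
    also have "2 * A * K\<^sup>2 * real s * (16 * real s powr (- 4)) = 32 * A * K\<^sup>2 * (real s powr 1 * real s powr (- 4))"
      by simp
    also have "real s powr 1 * real s powr (- 4) = real s powr (- 3)"
      by (simp only: powr_add[symmetric]) simp
    finally have "trunc N j k i * a j k * w j * w k \<le> 32 * A * K\<^sup>2 * real s powr (- 3)" .
    moreover have "0 \<le> trunc N j k i * a j k * w j * w k"
      using w trunc_nonneg[OF j k1 i] kernel_nonneg[OF j k1] by simp
    ultimately show ?thesis by (simp add: j_def)
  qed
  then have "(\<Sum>k = 1..s - 1. \<bar>trunc N (s - k) k i * a (s - k) k * w (s - k) * w k\<bar>)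
      \<le> (\<Sum>k = 1..s - 1. 32 * A * K\<^sup>2 * real s powr (- 3))"
    by (rule sum_mono)
  also have "\<dots> = real (s - 1) * (32 * A * K\<^sup>2 * real s powr (- 3))" by simp
  also have "\<dots> \<le> real s * (32 * A * K\<^sup>2 * real s powr (- 3))"
    using A by (intro mult_right_mono) auto
  also have "\<dots> = 32 * A * K\<^sup>2 * (real s powr 1 * real s powr (- 3))" by simp
  also have "real s powr 1 * real s powr (- 3) = real s powr (- 2)"
    by (simp only: powr_add[symmetric]) simp
  finally show ?thesis using sum_abs order_trans by fast
qed

lemma loss_term_bound:
  assumes K: "0 \<le> K" and w: "\<And>i. 0 \<le> w i" "\<And>i. w i \<le> K * real i powr (- 3)" "w 0 = 0" and i: "1 \<le> i"
  shows "\<bar>a i j * w j\<bar> \<le> 2 * A * real i * K * real j powr (- 2)"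
proof (cases "j = 0")
  case False
  then have j: "1 \<le> j" by simp
  have "a i j * w j \<le> (2 * A * (real i * real j)) * (K * real j powr (- 3))"
    using w kernel_le[OF i j] kernel_nonneg[OF i j] A by (intro mult_mono) auto
  also have "\<dots> = 2 * A * real i * K * (real j powr 1 * real j powr (- 3))" by simp
  also have "real j powr 1 * real j powr (- 3) = real j powr (- 2)"
    by (simp only: powr_add[symmetric]) simp
  finally show ?thesis using kernel_nonneg[OF i j] w by simp
qed (simp add: w)

text \<open>
  The stationary equation with all sums over \<^typ>\<open>nat\<close>, for rapidly decaying states. The value \<open>0\<close> at index \<open>0\<close>
  lets these sums agree with those over positive indices.
\<close>

definition balanced :: "(nat \<Rightarrow> real) \<Rightarrow> bool" where
  "balanced w \<longleftrightarrow> (\<forall>i. 0 \<le> w i) \<and> w 0 = 0 \<and> (\<forall>r. summable (\<lambda>i. real i powr r * w i)) \<and>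
     (\<forall>i\<ge>1. summable (\<lambda>j. a i j * w j) \<and> summable (gain_term a B w i) \<and>
        1 / 2 * (\<Sum>s. gain_term a B w i s) = (\<Sum>j. a i j * w j) * w i)"

text \<open>
  Systems of size \<open>n + k\<close> are relaxed to \<open>v\<close> at rate \<open>1 / (k + 1)\<close>. The weight \<open>1\<close> keeps their number above that of
  \<open>v\<close>, which the decay estimate needs; by decay no mass escapes to infinity in the limit.
\<close>

theorem balanced_exists:
  assumes n: "1 \<le> n" and \<rho>: "0 < \<rho>" and v: "v \<in> mass_simplex n \<rho>"
    and one: "collision_monotone (\<lambda>_. 1)"
  shows "\<exists>w. balanced w \<and> (\<Sum>i. real i * w i) = \<rho> \<and>
    (\<forall>\<phi>. collision_monotone \<phi> \<longrightarrow> (\<Sum>i = 1..n. \<phi> i * v i) \<le> (\<Sum>i. \<phi> i * w i))"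
proof -
  define \<delta> where "\<delta> k = 1 / real (Suc k)" for k
  have \<delta>: "0 < \<delta> k" "\<delta> k \<le> 1" for k by (auto simp: \<delta>_def)
  have "\<exists>w\<in>mass_simplex (n + k) \<rho>. relaxed_steady (n + k) (\<delta> k) v w" for k
    using n \<rho> \<delta> by (intro relaxed_steady_exists mass_simplex_mono[OF v]) auto
  then obtain x where x: "\<And>k. x k \<in> mass_simplex (n + k) \<rho>"
    and steady: "\<And>k. relaxed_steady (n + k) (\<delta> k) v (x k)"
    by metis
  have x0: "0 \<le> x k i" and x_supp: "i \<notin> {1..n + k} \<Longrightarrow> x k i = 0" for k i
    using x[of k] unfolding mass_simplex_def by blast+
  have finite_sum: "(\<Sum>i. \<phi> i * x k i) = (\<Sum>i = 1..n + k. \<phi> i * x k i)" for \<phi> k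
    by (rule suminf_finite) (use x_supp in auto)
  have v_sum: "(\<Sum>i = 1..n + k. \<phi> i * v i) = (\<Sum>i = 1..n. \<phi> i * v i)" for \<phi> k
    using v by (intro sum.mono_neutral_right) (auto simp: mass_simplex_def)
  have monotone: "(\<Sum>i = 1..n. \<phi> i * v i) \<le> (\<Sum>i = 1..n + k. \<phi> i * x k i)" if "collision_monotone \<phi>" for \<phi> k
    using relaxed_steady_monotone[OF steady[of k] \<delta>(1) that x0] unfolding v_sum .
  define \<nu> where "\<nu> = \<rho> / real n"
  have \<nu>: "0 < \<nu>" using \<rho> n by (simp add: \<nu>_def)
  \<comment> \<open>\<open>v\<close> lives on sizes at most \<open>n\<close>, hence its number is at least its mass divided by \<open>n\<close>\<close>
  have "\<nu> \<le> (\<Sum>i = 1..n. v i)"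
  proof -
    have "\<rho> = (\<Sum>i = 1..n. real i * v i)" using v by (simp add: mass_simplex_def)
    also have "\<dots> \<le> (\<Sum>i = 1..n. real n * v i)"
      using v by (intro sum_mono mult_right_mono) (auto simp: mass_simplex_def)
    finally show ?thesis using n by (simp add: \<nu>_def sum_distrib_left[symmetric] pos_divide_le_eq mult.commute)
  qed
  then have number: "\<nu> \<le> (\<Sum>i = 1..n + k. x k i)" for k
    using monotone[OF one, of k] by simp
  have decay: "\<exists>K\<ge>0. \<forall>k i. x k i \<le> K * real i powr (- r)" for r
  proof -
    obtain K where "0 \<le> K" and K: "\<forall>N\<ge>n. \<forall>\<delta> w i. 0 < \<delta> \<and> \<delta> \<le> 1 \<and> w \<in> mass_simplex N \<rho> \<and>
       relaxed_steady N \<delta> v w \<and> \<nu> \<le> (\<Sum>i = 1..N. w i) \<longrightarrow> w i \<le> K * real i powr (- r)"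
      using relaxed_steady_decay[OF \<rho> v \<nu>, of r] by blast
    have "x k i \<le> K * real i powr (- r)" for k i
      using K[rule_format, of "n + k" "\<delta> k" "x k" i] \<delta> x steady number by simp
    with \<open>0 \<le> K\<close> show ?thesis by blast
  qed
  obtain \<sigma> where \<sigma>: "strict_mono \<sigma>" "\<And>i. \<exists>l. (\<lambda>k. x (\<sigma> k) i) \<longlonglongrightarrow> l"
  proof (rule function_convergent_subsequence[of UNIV x \<rho>])
    show "norm (x k i) \<le> \<rho>" for k i using mass_simplex_le[OF x] x0 by simp
  qed auto
  then obtain w where lim: "\<And>i. (\<lambda>k. x (\<sigma> k) i) \<longlonglongrightarrow> w i" by metis
  have w0: "0 \<le> w i" for i
    by (rule tendsto_lowerbound[OF lim]) (auto simp: x0)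
  have wz: "w 0 = 0"
    using lim[of 0] x_supp[of 0] by (simp add: LIMSEQ_const_iff)
  have \<sigma>_inf: "filterlim \<sigma> at_top sequentially"
    by (rule filterlim_subseq) fact
  have moments: "summable (\<lambda>i. c i * w i)" "(\<lambda>k. \<Sum>i. c i * x (\<sigma> k) i) \<longlonglongrightarrow> (\<Sum>i. c i * w i)"
    if c: "\<And>i. 1 \<le> i \<Longrightarrow> \<bar>c i\<bar> \<le> C * real i powr q" and "0 \<le> C" for c C q
  proof -
    obtain K where K: "0 \<le> K" "\<And>k i. x k i \<le> K * real i powr (- (q + 2))" using decay by metis
    have bound: "\<bar>c i * x (\<sigma> k) i\<bar> \<le> C * K * real i powr (- 2)" for k i
    proof (cases "i = 0")
      case False
      have "\<bar>c i * x (\<sigma> k) i\<bar> \<le> (C * real i powr q) * (K * real i powr (- (q + 2)))"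
        using False c K x0 \<open>0 \<le> C\<close> unfolding abs_mult by (intro mult_mono) auto
      also have "\<dots> = C * K * (real i powr q * real i powr (- (q + 2)))" by simp
      also have "real i powr q * real i powr (- (q + 2)) = real i powr (- 2)"
        by (simp only: powr_add[symmetric]) simp
      finally show ?thesis .
    qed (simp add: x_supp)
    show "summable (\<lambda>i. c i * w i)" "(\<lambda>k. \<Sum>i. c i * x (\<sigma> k) i) \<longlonglongrightarrow> (\<Sum>i. c i * w i)"
      by (rule suminf_tendsto_of_decay[where x = "\<lambda>k i. c i * x (\<sigma> k) i", OF tendsto_mult_left[OF lim] bound])+
  qed
  show ?thesis
    unfolding balanced_def
  proof (intro exI[of _ w] conjI allI impI)
    show "summable (\<lambda>i. real i powr r * w i)" for r
      by (rule moments(1)[of _ 1 r]) auto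
    have "(\<lambda>k. \<Sum>i. real i * x (\<sigma> k) i) \<longlonglongrightarrow> (\<Sum>i. real i * w i)"
      by (rule moments(2)[of _ 1 1]) auto
    moreover have "(\<Sum>i. real i * x (\<sigma> k) i) = \<rho>" for k
      using x[of "\<sigma> k"] unfolding finite_sum by (simp add: mass_simplex_def)
    ultimately show "(\<Sum>i. real i * w i) = \<rho>" by (simp add: LIMSEQ_const_iff)
    show "(\<Sum>i = 1..n. \<phi> i * v i) \<le> (\<Sum>i. \<phi> i * w i)" if \<phi>: "collision_monotone \<phi>" for \<phi>
    proof -
      have \<phi>_bound: "\<bar>\<phi> i\<bar> \<le> (\<bar>\<phi> 1\<bar> + \<bar>\<phi> 2\<bar>) * real i powr 0" if "1 \<le> i" for i
      proof (cases "i = 1")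
        case False
        then have "2 \<le> i" using that by simp
        then have "\<phi> i = \<phi> 2" using \<phi> unfolding collision_monotone_def by blast
        then show ?thesis using that by simp
      qed simp
      have "(\<lambda>k. \<Sum>i. \<phi> i * x (\<sigma> k) i) \<longlonglongrightarrow> (\<Sum>i. \<phi> i * w i)"
        by (rule moments(2)[OF \<phi>_bound]) auto
      moreover have "\<forall>k. (\<Sum>i = 1..n. \<phi> i * v i) \<le> (\<Sum>i. \<phi> i * x (\<sigma> k) i)"
        unfolding finite_sum using monotone[OF \<phi>] by blast
      ultimately show ?thesis by (intro LIMSEQ_le_const) auto
    qed
    fix i :: nat assume i: "1 \<le> i"
    obtain K where K: "0 \<le> K" "\<And>k j. x k j \<le> K * real j powr (- 3)" using decay by metis
    note loss_lim = suminf_tendsto_of_decay[where x = "\<lambda>k j. a i j * x (\<sigma> k) j",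
        OF tendsto_mult_left[OF lim] loss_term_bound[OF K(1) x0 K(2) x_supp i]]
    show loss: "summable (\<lambda>j. a i j * w j)"
      by (rule loss_lim) simp
    have loss_lim: "(\<lambda>k. \<Sum>j. a i j * x (\<sigma> k) j) \<longlonglongrightarrow> (\<Sum>j. a i j * w j)"
      by (rule loss_lim) simp
    obtain L where L: "0 \<le> L" "\<And>k j. x k j \<le> L * real j powr (- 5)" using decay by metis
    define g where "g k s = (\<Sum>l = 1..s - 1. trunc (n + \<sigma> k) (s - l) l i * a (s - l) l * x (\<sigma> k) (s - l) * x (\<sigma> k) l)"
      for k s
    have g_lim: "(\<lambda>k. g k s) \<longlonglongrightarrow> gain_term a B w i s" for s
    proof -
      have trunc_lim: "(\<lambda>k. trunc (n + \<sigma> k) (s - l) l i) \<longlonglongrightarrow> B (s - l) l i" for l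
      \<comment> \<open>every fixed diagonal is eventually untouched by the truncation\<close>
      proof (rule tendsto_eventually)
        have "\<forall>\<^sub>F k in sequentially. s + l \<le> \<sigma> k"
          using eventually_compose_filterlim[OF eventually_ge_at_top[of "s + l"] \<sigma>_inf] .
        then show "\<forall>\<^sub>F k in sequentially. trunc (n + \<sigma> k) (s - l) l i = B (s - l) l i"
          by eventually_elim (simp add: trunc_def)
      qed
      show ?thesis unfolding g_def gain_term_def
        by (intro tendsto_sum tendsto_mult trunc_lim lim tendsto_const)
    qed
    have g_bound: "\<bar>g k s\<bar> \<le> 32 * A * L\<^sup>2 * real s powr (- 2)" for k s
      unfolding g_def by (rule gain_diagonal_bound[OF L(1) x0 L(2) i])
    show "summable (gain_term a B w i)"
      by (rule suminf_tendsto_of_decay(1)[OF g_lim g_bound])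
    have gain_lim: "(\<lambda>k. \<Sum>s. g k s) \<longlonglongrightarrow> (\<Sum>s. gain_term a B w i s)"
      by (rule suminf_tendsto_of_decay(2)[OF g_lim g_bound])
    have balance_lim: "(\<lambda>k. 1 / 2 * (\<Sum>s. g k s) - (\<Sum>j. a i j * x (\<sigma> k) j) * x (\<sigma> k) i + \<delta> (\<sigma> k) * (v i - x (\<sigma> k) i))
      \<longlonglongrightarrow> 1 / 2 * (\<Sum>s. gain_term a B w i s) - (\<Sum>j. a i j * w j) * w i + 0 * (v i - w i)"
    proof (intro tendsto_add tendsto_diff tendsto_mult tendsto_const gain_lim loss_lim lim)
      have "\<delta> \<longlonglongrightarrow> 0" unfolding \<delta>_def by (rule LIMSEQ_Suc[OF lim_1_over_n])
      then show "(\<lambda>k. \<delta> (\<sigma> k)) \<longlonglongrightarrow> 0"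
        using \<sigma>_inf by (rule filterlim_compose)
    qed
    have balance: "\<forall>\<^sub>F k in sequentially. 1 / 2 * (\<Sum>s. g k s) - (\<Sum>j. a i j * x (\<sigma> k) j) * x (\<sigma> k) i
        + \<delta> (\<sigma> k) * (v i - x (\<sigma> k) i) = 0"
      using eventually_compose_filterlim[OF eventually_ge_at_top[of i] \<sigma>_inf]
    proof eventually_elim
      case (elim k)
      have "(\<Sum>j. a i j * x (\<sigma> k) j) * x (\<sigma> k) i = (\<Sum>j = 1..n + \<sigma> k. a i j * x (\<sigma> k) i * x (\<sigma> k) j)"
        unfolding finite_sum sum_distrib_right by (simp add: mult_ac)
      moreover have "(\<Sum>s. g k s) = (\<Sum>j = 1..n + \<sigma> k. \<Sum>l = 1..n + \<sigma> k. trunc (n + \<sigma> k) j l i * a j l * x (\<sigma> k) j * x (\<sigma> k) l)"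
        unfolding g_def
        by (rule double_sum_by_diagonals[symmetric]) (use x_supp in auto)
      moreover have "net (n + \<sigma> k) (x (\<sigma> k)) i + \<delta> (\<sigma> k) * (v i - x (\<sigma> k) i) = 0"
        using steady[of "\<sigma> k"] i elim unfolding relaxed_steady_def by simp
      ultimately show ?case by (simp only: net_def)
    qed
    from LIMSEQ_unique[OF balance_lim tendsto_eventually[OF balance]] show "1 / 2 * (\<Sum>s. gain_term a B w i s) = (\<Sum>j. a i j * w j) * w i" by simp
  qed (fact w0 wz)+
qed

end

section \<open>Stationary solutions\<close>

lemma infsum_eq_suminf_of_nonneg:
  fixes f :: "nat \<Rightarrow> real"
  assumes "summable f" "\<And>i. 0 \<le> f i" "\<And>i. i < m \<Longrightarrow> f i = 0"
  shows "f summable_on {m..}" "infsum f {m..} = suminf f"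
proof -
  have "summable (\<lambda>i. norm (f i))" using assms by simp
  then have "(f has_sum suminf f) UNIV"
    using norm_summable_imp_has_sum[OF _ summable_sums[OF assms(1)]] by blast
  also have "(f has_sum suminf f) UNIV \<longleftrightarrow> (f has_sum suminf f) {m..}"
    by (rule has_sum_cong_neutral) (auto intro: assms(3))
  finally show "f summable_on {m..}" "infsum f {m..} = suminf f"
    by (auto simp: summable_on_def infsumI)
qed

lemma moment_eq_suminf:
  assumes "summable (\<lambda>i. real i powr \<gamma> * w i)" "\<And>i. 0 \<le> w i"
  shows "w \<in> Y \<gamma>" "moment \<gamma> w = (\<Sum>i. real i powr \<gamma> * w i)"
  using infsum_eq_suminf_of_nonneg[OF assms(1), of 1] assms(2)
  by (auto simp: Y_def moment_def)

lemma series_in_L1_const: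
  assumes "f summable_on J"
  shows "series_in_L1 t J (\<lambda>_. f)"
proof -
  have "emeasure lborel {0<..<t} < \<infinity>"
    by (rule emeasure_bounded_finite) simp
  then show ?thesis
    using assms by (auto simp: series_in_L1_def set_integrable_def)
qed

context breakage begin

lemma balanced_stationary:
  assumes "balanced w"
  shows "stationary_solution a B w"
proof -
  have w: "0 \<le> w i" "w 0 = 0" "summable (\<lambda>i. real i powr r * w i)" for i r
    using assms unfolding balanced_def by blast+
  have loss: "summable (\<lambda>j. a i j * w j)" and gain: "summable (gain_term a B w i)"
    and balance: "1 / 2 * (\<Sum>s. gain_term a B w i s) = (\<Sum>j. a i j * w j) * w i" if "1 \<le> i" for i
    using assms that unfolding balanced_def by blast+
  have aw: "0 \<le> a i j * w j" if "1 \<le> i" for i j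
    using kernel_nonneg[OF that, of j] w by (cases "j = 0") auto
  have loss_sum: "(\<lambda>j. a i j * w j) summable_on {1..}" if "1 \<le> i" for i
    by (rule infsum_eq_suminf_of_nonneg(1)[OF loss[OF that]]) (use aw that w in auto)
  have loss_inf: "(\<Sum>\<^sub>\<infinity>j\<in>{1..}. a i j * w i * w j) = (\<Sum>j. a i j * w j) * w i" if "1 \<le> i" for i
  proof -
    have "(\<Sum>\<^sub>\<infinity>j\<in>{1..}. a i j * w i * w j) = (\<Sum>\<^sub>\<infinity>j\<in>{1..}. a i j * w j * w i)"
      by (simp add: mult_ac)
    also have "\<dots> = (\<Sum>\<^sub>\<infinity>j\<in>{1..}. a i j * w j) * w i"
      by (rule infsum_cmult_left) (use loss_sum[OF that] in simp)
    also have "(\<Sum>\<^sub>\<infinity>j\<in>{1..}. a i j * w j) = (\<Sum>j. a i j * w j)"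
      by (rule infsum_eq_suminf_of_nonneg(2)[OF loss[OF that]]) (use aw that w in auto)
    finally show ?thesis .
  qed
  have g0: "0 \<le> gain_term a B w i s" if "1 \<le> i" for i s
    unfolding gain_term_def using that w
    by (intro sum_nonneg mult_nonneg_nonneg) (auto intro: B_nonneg kernel_nonneg)
  have gz: "gain_term a B w i s = 0" if "s < i + 1" for i s
    unfolding gain_term_def using that by (intro sum.neutral) (auto simp: B_zero)
  note gain_inf = infsum_eq_suminf_of_nonneg[OF gain g0 gz]
  have rhs: "breakage_rhs a B w i = 0" if "1 \<le> i" for i
    unfolding breakage_rhs_def loss_inf[OF that]
    using gain_inf(2)[OF that that] balance[OF that] by simp
  have "w \<in> Y_plus 1" using w moment_eq_suminf(1)[OF w(3,1)] by (simp add: Y_plus_def)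
  moreover have "is_solution a B \<infinity> w (\<lambda>_. w)"
    unfolding is_solution_def
    using \<open>w \<in> Y_plus 1\<close> w rhs gain_inf(1) loss_sum
    by (auto intro!: series_in_L1_const)
  ultimately show ?thesis by (simp add: stationary_solution_def)
qed

text \<open>
  The target \<open>v\<close> has \<open>\<rho>\<^sub>0 - y\<close> monomers and \<open>y > 0\<close> clusters of one size \<open>n \<ge> 2\<close>, where \<open>y\<close> is determined by the mass
  and \<open>n\<close> is so large that \<open>y \<le> \<rho>\<^sub>0\<close>. A weight with value \<open>c\<close> on monomers and \<open>d\<close> elsewhere has the total
  \<open>c (\<rho>\<^sub>0 - y) + d y\<close> on it.
\<close>

lemma stationary_solution_exists:
  assumes one: "collision_monotone (\<lambda>_. 1)" and \<rho>: "0 < \<rho>\<^sub>0" "\<rho>\<^sub>0 < \<rho>\<^sub>1"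
  shows "\<exists>w y. stationary_solution a B w \<and> w \<in> (\<Inter>m\<in>{1::real..}. Y m) \<and> moment 1 w = \<rho>\<^sub>1 \<and> 0 < y \<and>
    (\<forall>c d. collision_monotone (\<lambda>i. if i = 1 then c else d) \<longrightarrow>
       c * (\<rho>\<^sub>0 - y) + d * y \<le> c * w 1 + d * (moment 0 w - w 1))"
proof -
  obtain n where n: "2 \<le> n" "\<rho>\<^sub>1 / \<rho>\<^sub>0 \<le> real n"
    using real_arch_simple[of "max 2 (\<rho>\<^sub>1 / \<rho>\<^sub>0)"] by auto
  define y where "y = (\<rho>\<^sub>1 - \<rho>\<^sub>0) / (real n - 1)"
  have y: "0 < y" using n \<rho> by (simp add: y_def)
  have "\<rho>\<^sub>1 \<le> real n * \<rho>\<^sub>0" using n \<rho> by (simp add: pos_divide_le_eq)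
  then have y_le: "y \<le> \<rho>\<^sub>0" using n by (simp add: y_def pos_divide_le_eq algebra_simps)
  define v where "v i = (\<rho>\<^sub>0 - y) * of_bool (i = 1) + y * of_bool (i = n)" for i :: nat
  have v_sum: "(\<Sum>i = 1..n. \<phi> i * v i) = \<phi> 1 * (\<rho>\<^sub>0 - y) + \<phi> n * y" for \<phi>
  proof -
    have "(\<Sum>i = 1..n. \<phi> i * v i) = (\<Sum>i = 1..n. if i = 1 then \<phi> i * (\<rho>\<^sub>0 - y) else 0)
        + (\<Sum>i = 1..n. if i = n then \<phi> i * y else 0)"
      unfolding sum.distrib[symmetric] by (intro sum.cong) (auto simp: v_def algebra_simps)
    then show ?thesis using n by simp
  qed
  have v: "v \<in> mass_simplex n \<rho>\<^sub>1"
  proof -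
    have "(\<rho>\<^sub>0 - y) + real n * y = \<rho>\<^sub>1"
    proof -
      have "y * (real n - 1) = \<rho>\<^sub>1 - \<rho>\<^sub>0" using n by (simp add: y_def)
      then show ?thesis by (simp add: algebra_simps)
    qed
    then show ?thesis
      using v_sum[of real] y y_le n by (auto simp: mass_simplex_def v_def)
  qed
  have "1 \<le> n" "0 < \<rho>\<^sub>1" using n \<rho> by auto
  obtain w where "balanced w" and mass: "(\<Sum>i. real i * w i) = \<rho>\<^sub>1"
    and mono: "\<And>\<phi>. collision_monotone \<phi> \<Longrightarrow> (\<Sum>i = 1..n. \<phi> i * v i) \<le> (\<Sum>i. \<phi> i * w i)"
    using balanced_exists[OF \<open>1 \<le> n\<close> \<open>0 < \<rho>\<^sub>1\<close> v one] by blast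
  have w: "0 \<le> w i" "w 0 = 0" "summable (\<lambda>i. real i powr r * w i)" for i r
    using \<open>balanced w\<close> unfolding balanced_def by blast+
  have Y: "w \<in> Y r" for r
    by (rule moment_eq_suminf[OF w(3,1)])
  have powr0: "real i powr 0 * w i = w i" for i
    using w(2) by (cases "i = 0") auto
  have number: "summable w" "moment 0 w = (\<Sum>i. w i)"
    using w(3)[of 0] moment_eq_suminf(2)[OF w(3)[of 0] w(1)] unfolding powr0 by auto
  have mass: "moment 1 w = \<rho>\<^sub>1"
    using moment_eq_suminf(2)[OF w(3)[of 1] w(1)] mass by simp
  have split: "(\<Sum>i. (if i = 1 then c else d) * w i) = c * w 1 + d * (moment 0 w - w 1)" for c d :: real
  proof -
    have "(\<lambda>i. (if i = 1 then (c - d) * w i else 0) + d * w i) sums ((c - d) * w 1 + d * (\<Sum>i. w i))"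
      using number(1) by (intro sums_add sums_mult summable_sums sums_single)
    also have "(\<lambda>i. (if i = 1 then (c - d) * w i else 0) + d * w i) = (\<lambda>i. (if i = 1 then c else d) * w i)"
      by (auto simp: algebra_simps)
    finally show ?thesis by (simp add: sums_iff number(2) algebra_simps)
  qed
  show ?thesis
  proof (intro exI[of _ w] exI[of _ y] conjI allI impI)
    show "stationary_solution a B w"
      by (rule balanced_stationary) fact
    show "c * (\<rho>\<^sub>0 - y) + d * y \<le> c * w 1 + d * (moment 0 w - w 1)"
      if "collision_monotone (\<lambda>i. if i = 1 then c else d)" for c d
      using mono[OF that] n unfolding split v_sum by simp
  qed (use Y mass y in auto)
qed

end

theorem theorem2p5:
  fixes A \<alpha> \<beta> :: real
    and a :: "nat \<Rightarrow> nat \<Rightarrow> real"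
    and B :: "nat \<Rightarrow> nat \<Rightarrow> nat \<Rightarrow> real"
  assumes "A > 0" and "\<alpha> \<le> \<beta>" and "\<beta> \<le> 1" and "\<beta> > 0" and "\<alpha> < 1"
    and "\<And>i j. i \<ge> 1 \<Longrightarrow> j \<ge> 1 \<Longrightarrow>
           a i j = A * (real i powr \<alpha> * real j powr \<beta> + real i powr \<beta> * real j powr \<alpha>)"
    and "condB1 B" and "condB2 B" and "condB3 B"
  shows
    "((\<forall>j\<ge>1. \<forall>k\<ge>1. (\<Sum>i = 1..j + k - 1. B j k i) = 2) \<longrightarrow>
        (\<forall>\<rho>\<^sub>0 \<rho>\<^sub>1. 0 < \<rho>\<^sub>0 \<and> \<rho>\<^sub>0 < \<rho>\<^sub>1 \<longrightarrow>
           (\<exists>w. w \<in> Y_plus 1 \<and> stationary_solution a B w \<and>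
                moment 1 w = \<rho>\<^sub>1 \<and> moment 0 w = \<rho>\<^sub>0 \<and>
                w \<in> (\<Inter>m\<in>{1::real..}. Y m))))
     \<and>
     ((\<forall>j\<ge>2. 1 \<le> (\<Sum>i = 2..j. B 1 j i)) \<and>
      (\<forall>j\<ge>2. \<forall>k\<ge>2. 2 \<le> (\<Sum>i = 2..j + k - 1. B j k i)) \<longrightarrow>
        (\<forall>\<rho>\<^sub>0 \<rho>\<^sub>1. 0 < \<rho>\<^sub>0 \<and> \<rho>\<^sub>0 < \<rho>\<^sub>1 \<longrightarrow>
           (\<exists>w. w \<in> Y_plus 1 \<and> stationary_solution a B w \<and>
                w \<in> (\<Inter>m\<in>{1::real..}. Y m) \<and>
                moment 1 w = \<rho>\<^sub>1 \<and> moment 0 w \<ge> \<rho>\<^sub>0 \<and> w 1 < moment 0 w)))"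
proof (intro conjI impI allI; elim conjE)
  interpret breakage A \<alpha> \<beta> a B
    by unfold_locales (use assms in auto)
  have one: "collision_monotone (\<lambda>_. 1)"
    using \<open>condB3 B\<close> by (simp add: collision_monotone_def condB3_def)
  {
    fix \<rho>\<^sub>0 \<rho>\<^sub>1 :: real
    assume two: "\<forall>j\<ge>1. \<forall>k\<ge>1. (\<Sum>i = 1..j + k - 1. B j k i) = 2" and \<rho>: "0 < \<rho>\<^sub>0" "\<rho>\<^sub>0 < \<rho>\<^sub>1"
    obtain w y where w: "stationary_solution a B w" "w \<in> (\<Inter>m\<in>{1::real..}. Y m)" "moment 1 w = \<rho>\<^sub>1"
      and lower: "\<And>c d. collision_monotone (\<lambda>i. if i = 1 then c else d) \<Longrightarrow>
         c * (\<rho>\<^sub>0 - y) + d * y \<le> c * w 1 + d * (moment 0 w - w 1)"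
      using stationary_solution_exists[OF one \<rho>] by blast
    have "collision_monotone (\<lambda>i. if i = 1 then c else c)" if "c = 1 \<or> c = - 1" for c :: real
      using that two by (auto simp: collision_monotone_def sum_negf)
    from lower[OF this[of 1]] lower[OF this[of "- 1"]] have "moment 0 w = \<rho>\<^sub>0" by simp
    with w show "\<exists>w. w \<in> Y_plus 1 \<and> stationary_solution a B w \<and>
        moment 1 w = \<rho>\<^sub>1 \<and> moment 0 w = \<rho>\<^sub>0 \<and> w \<in> (\<Inter>m\<in>{1::real..}. Y m)"
      by (auto simp: stationary_solution_def)
  next
    fix \<rho>\<^sub>0 \<rho>\<^sub>1 :: real
    assume one_j: "\<forall>j\<ge>2. 1 \<le> (\<Sum>i = 2..j. B 1 j i)"
      and two: "\<forall>j\<ge>2. \<forall>k\<ge>2. 2 \<le> (\<Sum>i = 2..j + k - 1. B j k i)" and \<rho>: "0 < \<rho>\<^sub>0" "\<rho>\<^sub>0 < \<rho>\<^sub>1"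
    obtain w y where w: "stationary_solution a B w" "w \<in> (\<Inter>m\<in>{1::real..}. Y m)" "moment 1 w = \<rho>\<^sub>1"
      and "0 < y" and lower: "\<And>c d. collision_monotone (\<lambda>i. if i = 1 then c else d) \<Longrightarrow>
         c * (\<rho>\<^sub>0 - y) + d * y \<le> c * w 1 + d * (moment 0 w - w 1)"
      using stationary_solution_exists[OF one \<rho>] by blast
    \<comment> \<open>the hypotheses of (b) say that no collision decreases the number of clusters of size at least \<open>2\<close>\<close>
    have "collision_monotone (\<lambda>i. if i = 1 then 0 else 1)"
    proof -
      have large: "(\<Sum>i = 1..N. (if i = 1 then 0 else 1) * b i) = (\<Sum>i = 2..N. b i)"
        for N and b :: "nat \<Rightarrow> real"
      proof -
        have "(\<Sum>i = 1..N. (if i = 1 then 0 else 1) * b i) = (\<Sum>i = 2..N. (if i = 1 then 0 else 1) * b i)"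
          by (rule sum.mono_neutral_right) auto
        also have "\<dots> = (\<Sum>i = 2..N. b i)"
          by (rule sum.cong) auto
        finally show ?thesis .
      qed
      have sym: "B j 1 i = B 1 j i" if "1 \<le> j" "i \<in> {1..j}" for j i
      proof -
        have "\<forall>s\<in>{1..j + 1 - 1}. B j 1 s = B 1 j s \<and> 0 \<le> B j 1 s"
          using \<open>condB1 B\<close> that(1) unfolding condB1_def by blast
        then show ?thesis using that(2) by simp
      qed
      have "(if j = 1 then 0 else 1) + (if k = 1 then 0 else 1 :: real) \<le> (\<Sum>i = 2..j + k - 1. B j k i)"
        if jk: "1 \<le> j" "1 \<le> k" for j k
      proof -
        consider "j = 1" "k = 1" | "j = 1" "2 \<le> k" | "2 \<le> j" "k = 1" | "2 \<le> j" "2 \<le> k"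
        proof -
          have "j = 1 \<or> 2 \<le> j" "k = 1 \<or> 2 \<le> k" using jk by auto
          then show thesis using that by blast
        qed
        then show ?thesis
        proof cases
          case 3
          then have "(\<Sum>i = 2..j. B j 1 i) = (\<Sum>i = 2..j. B 1 j i)"
            by (intro sum.cong sym) auto
          then show ?thesis using 3 one_j by simp
        qed (use one_j two in auto)
      qed
      then show ?thesis unfolding collision_monotone_def large by auto
    qed
    from lower[OF this] \<open>0 < y\<close> have "w 1 < moment 0 w" by simp
    moreover have "\<rho>\<^sub>0 \<le> moment 0 w"
      using lower[of 1 1] one by simp
    ultimately show "\<exists>w. w \<in> Y_plus 1 \<and> stationary_solution a B w \<and> w \<in> (\<Inter>m\<in>{1::real..}. Y m) \<and>
        moment 1 w = \<rho>\<^sub>1 \<and> moment 0 w \<ge> \<rho>\<^sub>0 \<and> w 1 < moment 0 w"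
      using w by (auto simp: stationary_solution_def)
  }
qed

end
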